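(* Let $X$ be a stratifiable scattered space of finite scattered height. The function space $C_k(X)$ is Baire if and only if $X$ has the Moving Off Property.
   Context: $C_k(X)$ is the space of continuous real-valued functions on $X$ endowed with the compact-open topology. A topological space is Baire if the intersection of any sequence of open dense subsets is dense. A point $x$ of a space $A$ is isolated in $A$ if $\{x\}$ is clopen in $A$; $A'$ denotes the set of non-isolated points of the space $A$. A space is scattered if each non-empty subspace of it contains an isolated point. Put $X^{[0]}=X$ and $X^{[\alpha]}=\bigcap_{\beta<\alpha}(X^{[\beta]})'$ for ordinals $\alpha>0$; the scattered height of $X$ is the smallest ordinal $\alpha$ with $X^{[\alpha]}=X^{[\alpha+1]}$. Stratifiable: a regular space $X$ (regular spaces are understood to be $T_1$) is stratifiable if to each $x\in X$ one can assign a decreasing sequence $(U_n(x))_{n\in\omega}$ of neighborhoods of $x$ such that each closed set $F\subset X$ equals $\bigcap_{n\in\omega}\overline{U_n[F]}$, where $U_n[F]=\bigcup_{x\in F}U_n(x)$. Moving Off Property: a family $\mathcal F$ of subsets of $X$ is a moving off family if for any compact $K\subset X$ there is a non-empty $F\in\mathcal F$ with $K\cap F=\emptyset$. A family $\mathcal F$ is strongly discrete if each $F\in\mathcal F$ has an open neighborhood $O_F\subset X$ such that the indexed family $\{O_F\}_{F\in\mathcal F}$ is discrete, i.e. each $x\in X$ has a neighborhood meeting $O_F$ for at most one index $F\in\mathcal F$. $X$ has the Moving Off Property if each moving off family of compact subsets of $X$ contains an infinite strongly discrete subfamily. *)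

theory Defs
  imports "HOL-Analysis.Analysis"
begin

text \<open>Spaces are abstract topologies, so the point set is \<^term>\<open>topspace X\<close> and may be empty.\<close>

subsection \<open>Function spaces and the Baire property\<close>

text \<open>Elements of the function space are restricted to \<^const>\<open>extensional\<close> functions, so that each
  continuous function on \<^term>\<open>topspace X\<close> is represented by exactly one HOL function.\<close>

definition continuous_funs :: "'a topology \<Rightarrow> ('a \<Rightarrow> real) set" where
  "continuous_funs X = {f \<in> extensional (topspace X). continuous_map X euclideanreal f}"

definition compact_open_topology :: "'a topology \<Rightarrow> ('a \<Rightarrow> real) topology" where
  "compact_open_topology X =
     topology_generated_by
       {{f \<in> continuous_funs X. f ` K \<subseteq> U} | K U. compactin X K \<and> open U}"

lemma topspace_compact_open_topology:
  "topspace (compact_open_topology X) = continuous_funs X"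
proof -
  have "continuous_funs X \<in> {{f \<in> continuous_funs X. f ` K \<subseteq> U} | K U. compactin X K \<and> open U}"
    by (rule CollectI, rule exI[of _ "{}"], rule exI[of _ UNIV]) auto
  then show ?thesis
    unfolding compact_open_topology_def topology_generated_by_topspace by blast
qed

definition baire_space :: "'b topology \<Rightarrow> bool" where
  "baire_space Y \<longleftrightarrow>
     (\<forall>G :: nat \<Rightarrow> 'b set.
        (\<forall>n. openin Y (G n) \<and> Y closure_of (G n) = topspace Y) \<longrightarrow>
        Y closure_of (\<Inter>n. G n) = topspace Y)"

subsection \<open>Scattered spaces\<close>

definition isolated_point_of :: "'a topology \<Rightarrow> 'a set \<Rightarrow> 'a \<Rightarrow> bool" where
  "isolated_point_of X A x \<longleftrightarrow>
     x \<in> A \<and> openin (subtopology X A) {x} \<and> closedin (subtopology X A) {x}"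

definition nonisolated_points :: "'a topology \<Rightarrow> 'a set \<Rightarrow> 'a set" where
  "nonisolated_points X A = {x \<in> A. \<not> isolated_point_of X A x}"

definition scattered_space :: "'a topology \<Rightarrow> bool" where
  "scattered_space X \<longleftrightarrow>
     (\<forall>A. A \<subseteq> topspace X \<and> A \<noteq> {} \<longrightarrow> (\<exists>x. isolated_point_of X A x))"

text \<open>The derivatives of finite order only.  Those of infinite order play no role in finiteness of
  the scattered height: the least ordinal \<open>\<alpha>\<close> at which the \<open>\<alpha>\<close>-th and \<open>(\<alpha> + 1)\<close>-st derivatives agree
  is finite iff they agree at some natural number.\<close>

fun scattered_derivative :: "'a topology \<Rightarrow> nat \<Rightarrow> 'a set" where
  "scattered_derivative X n =
     (if n = 0 then topspace X
      else (\<Inter>k\<in>{..<n}. nonisolated_points X (scattered_derivative X k)))"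

declare scattered_derivative.simps [simp del]

definition finite_scattered_height :: "'a topology \<Rightarrow> bool" where
  "finite_scattered_height X \<longleftrightarrow>
     (\<exists>n. scattered_derivative X n = scattered_derivative X (Suc n))"

subsection \<open>Stratifiable spaces\<close>

text \<open>The sets \<open>U x n\<close> are neighbourhoods of \<open>x\<close> that need not be open.\<close>

definition stratifiable_space :: "'a topology \<Rightarrow> bool" where
  "stratifiable_space X \<longleftrightarrow>
     regular_space X \<and> t1_space X \<and>
     (\<exists>U :: 'a \<Rightarrow> nat \<Rightarrow> 'a set.
        (\<forall>x\<in>topspace X. \<forall>n. U x n \<subseteq> topspace X \<and> (\<exists>V. openin X V \<and> x \<in> V \<and> V \<subseteq> U x n)) \<and>
        (\<forall>x\<in>topspace X. \<forall>n. U x (Suc n) \<subseteq> U x n) \<and>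
        (\<forall>F. closedin X F \<longrightarrow> F = (\<Inter>n. X closure_of (\<Union>x\<in>F. U x n))))"

subsection \<open>The Moving Off Property\<close>

definition moving_off_family :: "'a topology \<Rightarrow> 'a set set \<Rightarrow> bool" where
  "moving_off_family X \<F> \<longleftrightarrow>
     (\<forall>F\<in>\<F>. F \<subseteq> topspace X) \<and>
     (\<forall>K. compactin X K \<longrightarrow> (\<exists>F\<in>\<F>. F \<noteq> {} \<and> K \<inter> F = {}))"

text \<open>Discreteness is that of the family of neighbourhoods indexed by the members of \<open>\<F>\<close>: distinct
  members with equal neighbourhoods are counted separately.\<close>

definition strongly_discrete_family :: "'a topology \<Rightarrow> 'a set set \<Rightarrow> bool" where
  "strongly_discrete_family X \<F> \<longleftrightarrow>
     (\<exists>V :: 'a set \<Rightarrow> 'a set.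
        (\<forall>F\<in>\<F>. openin X (V F) \<and> F \<subseteq> V F) \<and>
        (\<forall>x\<in>topspace X. \<exists>W. openin X W \<and> x \<in> W \<and>
           (\<forall>F\<in>\<F>. \<forall>G\<in>\<F>. W \<inter> V F \<noteq> {} \<and> W \<inter> V G \<noteq> {} \<longrightarrow> F = G)))"

definition moving_off_property :: "'a topology \<Rightarrow> bool" where
  "moving_off_property X \<longleftrightarrow>
     (\<forall>\<F>. (\<forall>F\<in>\<F>. compactin X F) \<and> moving_off_family X \<F> \<longrightarrow>
        (\<exists>\<G>. \<G> \<subseteq> \<F> \<and> infinite \<G> \<and> strongly_discrete_family X \<G>))"

end

theory Submission
  imports Defs
begin

text \<open>If \<open>C\<^sub>k(X)\<close> is Baire, then a moving off family contains, for a generic \<open>f\<close>, members on which \<open>f\<close>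
  exceeds any given bound, and the values of \<open>f\<close> separate infinitely many of them.

  Conversely, let \<open>X\<close> have the Moving Off Property.  Stratifiability provides retractions \<open>r\<^sub>k\<close> of \<open>X\<close>
  onto its finite derivatives, and a continuous function splits into coefficients at the points of \<open>X\<close>, the
  one at an isolated point \<open>x\<close> of the \<open>k\<close>-th derivative spreading over the clopen fibre of \<open>r\<^sub>k\<close> over \<open>x\<close>.
  Meeting dense open sets one after the other thus takes modifications at finitely many points, which are small
  at the points of any prescribed compact set.  If the points of large modification form a locally
  finite sequence of finite sets, the process converges locally uniformly.  This can be arranged since every
  strategy that answers compact sets by compact sets disjoint from them has a locally finite run: an infinite
  strongly discrete family is itself moving off, so the tree of positions can be pruned to a countable one, and
  the Moving Off Property then applies to unions of moves from finitely many nodes.\<close>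

subsection \<open>Function spaces\<close>

text \<open>A three-term estimate with \<open>e / 3\<close>. The approximant \<open>g\<close> may
  depend on \<open>x\<close> and \<open>e\<close> and need only be close on \<open>W\<close>, which
  suits both gluing along clopen sets and locally uniform limits.\<close>

lemma continuous_map_real_locally_approx:
  fixes f :: "'a \<Rightarrow> real"
  assumes "\<And>x e. x \<in> topspace X \<Longrightarrow> 0 < e \<Longrightarrow>
             \<exists>W g. openin X W \<and> x \<in> W \<and> continuous_map X euclideanreal g \<and>
               (\<forall>y\<in>W. \<bar>f y - g y\<bar> < e)"
  shows "continuous_map X euclideanreal f"
proof -
  have "\<exists>U. openin X U \<and> x \<in> U \<and> (\<forall>y\<in>U. f y \<in> V)"
    if x: "x \<in> topspace X" and V: "open V" "f x \<in> V" for x V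
  proof -
    obtain e where e: "e > 0" "ball (f x) e \<subseteq> V"
      using V open_contains_ball by blast
    obtain W g where W: "openin X W" "x \<in> W" "continuous_map X euclideanreal g"
      "\<forall>y\<in>W. \<bar>f y - g y\<bar> < e / 3"
      using assms[OF x, of "e / 3"] e by (metis divide_pos_pos zero_less_numeral)
    define U where "U = W \<inter> {y \<in> topspace X. g y \<in> ball (g x) (e / 3)}"
    have "openin X U"
      unfolding U_def using W(1) openin_continuous_map_preimage[OF W(3), of "ball (g x) (e / 3)"]
      by (simp add: openin_Int)
    moreover have "x \<in> U"
      using W x e by (auto simp: U_def)
    moreover have "f y \<in> V" if "y \<in> U" for y
    proof -
      have "\<bar>f y - g y\<bar> < e / 3" "\<bar>f x - g x\<bar> < e / 3" "\<bar>g x - g y\<bar> < e / 3"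
        using that W by (auto simp: U_def dist_real_def)
      then have "dist (f x) (f y) < e"
        unfolding dist_real_def by linarith
      then show ?thesis
        using e by auto
    qed
    ultimately show ?thesis
      by blast
  qed
  then show ?thesis
    by (simp add: continuous_map_eq_topcontinuous_at topcontinuous_at_def)
qed

lemma continuous_map_real_clopen_cases:
  fixes c :: "'a \<Rightarrow> real"
  assumes "continuous_map X euclideanreal c" "openin X P" "closedin X P"
  shows "continuous_map X euclideanreal (\<lambda>y. if y \<in> P then c y else 0)"
proof (rule continuous_map_real_locally_approx)
  fix x and e :: real assume x: "x \<in> topspace X" and e: "0 < e"
  show "\<exists>W g. openin X W \<and> x \<in> W \<and> continuous_map X euclideanreal g \<and>
               (\<forall>y\<in>W. \<bar>(if y \<in> P then c y else 0) - g y\<bar> < e)"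
  proof (cases "x \<in> P")
    case True
    then show ?thesis
      using assms e by (intro exI[of _ P] exI[of _ c]) auto
  next
    case False
    then show ?thesis
      using assms e x by (intro exI[of _ "topspace X - P"] exI[of _ "\<lambda>_. 0"]) auto
  qed
qed

section \<open>Uniform neighbourhoods in the compact-open topology\<close>

lemma restrict_in_continuous_funs:
  assumes "continuous_map X euclideanreal f"
  shows "restrict f (topspace X) \<in> continuous_funs X"
  unfolding continuous_funs_def
  using assms by (auto intro: continuous_map_eq)

text \<open>For compact \<open>K\<close> and positive \<open>e\<close> these sets serve as a
  neighbourhood base at \<open>f\<close>. The lemmas below compare them with open sets rather than
  proving them open.\<close>

definition unif_nbhd :: "'a topology \<Rightarrow> ('a \<Rightarrow> real) \<Rightarrow> 'a set \<Rightarrow> real \<Rightarrow> ('a \<Rightarrow> real) set" where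
  "unif_nbhd X f K e = {h \<in> continuous_funs X. \<forall>x\<in>K. \<bar>h x - f x\<bar> < e}"

lemma unif_nbhd_mono:
  assumes "K \<subseteq> K'" "e' \<le> e"
  shows "unif_nbhd X f K' e' \<subseteq> unif_nbhd X f K e"
  using assms by (fastforce simp: unif_nbhd_def)

text \<open>Induction over the generation of open sets. In the subbasic case some
  \<open>e\<close>-neighbourhood of the compact image of \<open>K\<close> under \<open>f\<close>
  stays inside \<open>U\<close>.\<close>

lemma unif_nbhd_subset_open:
  assumes "openin (compact_open_topology X) A" "f \<in> A"
  obtains K e where "compactin X K" "e > 0" "unif_nbhd X f K e \<subseteq> A"
proof -
  let ?S = "{{f \<in> continuous_funs X. f ` K \<subseteq> U} | K U. compactin X K \<and> open U}"
  have "generate_topology_on ?S A"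
    using assms(1) by (simp add: compact_open_topology_def openin_topology_generated_by_iff)
  then have "f \<in> A \<Longrightarrow> \<exists>K e. compactin X K \<and> e > 0 \<and> unif_nbhd X f K e \<subseteq> A"
  proof (induction rule: generate_topology_on.induct)
    case Empty
    then show ?case by simp
  next
    case (Int a b)
    then obtain K e K' e' where "compactin X K" "e > 0" "unif_nbhd X f K e \<subseteq> a"
      "compactin X K'" "e' > 0" "unif_nbhd X f K' e' \<subseteq> b"
      by auto
    moreover have "unif_nbhd X f (K \<union> K') (min e e') \<subseteq> unif_nbhd X f K e"
      "unif_nbhd X f (K \<union> K') (min e e') \<subseteq> unif_nbhd X f K' e'"
      by (rule unif_nbhd_mono; simp)+
    ultimately show ?case
      by (intro exI[of _ "K \<union> K'"] exI[of _ "min e e'"]) (auto intro: compactin_Un)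
  next
    case (UN \<K>)
    then obtain k where "k \<in> \<K>" "f \<in> k"
      by auto
    with UN.IH[of k] show ?case
      by blast
  next
    case (Basis s)
    then obtain K U where s: "s = {f \<in> continuous_funs X. f ` K \<subseteq> U}" "compactin X K" "open U"
      by blast
    have "continuous_map X euclideanreal f"
      using Basis s by (auto simp: continuous_funs_def)
    then have "compact (f ` K)"
      using image_compactin s(2) compactin_euclidean_iff by blast
    moreover have "f ` K \<subseteq> U"
      using Basis s by auto
    ultimately obtain e where "e > 0" "(\<Union>x\<in>f ` K. ball x e) \<subseteq> U"
      using compact_subset_open_imp_ball_epsilon_subset s(3) by metis
    moreover have "unif_nbhd X f K e \<subseteq> s"
    proof
      fix h assume h: "h \<in> unif_nbhd X f K e"
      have "h x \<in> U" if "x \<in> K" for x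
      proof -
        have "h x \<in> ball (f x) e"
          using h that by (auto simp: unif_nbhd_def dist_real_def abs_minus_commute)
        then show ?thesis
          using \<open>(\<Union>x\<in>f ` K. ball x e) \<subseteq> U\<close> that by blast
      qed
      then show "h \<in> s"
        using h s by (auto simp: unif_nbhd_def)
    qed
    ultimately show ?case
      using s by blast
  qed
  then show thesis
    using assms(2) that by blast
qed

text \<open>\<open>K\<close> is cut into finitely many compact pieces on which \<open>f\<close> is
  almost constant, and each piece contributes one subbasic condition.\<close>

lemma open_subset_unif_nbhd:
  assumes f: "f \<in> continuous_funs X" and K: "compactin X K" and e: "e > 0"
  obtains A where "openin (compact_open_topology X) A" "f \<in> A" "A \<subseteq> unif_nbhd X f K e"
proof -
  have cf: "continuous_map X euclideanreal f"
    using f by (auto simp: continuous_funs_def)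
  have "compact (f ` K)"
    using image_compactin[OF K cf] compactin_euclidean_iff by blast
  have "f ` K \<subseteq> (\<Union>t\<in>f ` K. ball t (e / 4))"
    using e by auto
  with \<open>compact (f ` K)\<close> obtain T where T: "finite T" "f ` K \<subseteq> (\<Union>t\<in>T. ball t (e / 4))"
    using compactE_image[of "f ` K" "f ` K" "\<lambda>t. ball t (e / 4)"] by (metis open_ball)
  \<comment> \<open>Closed balls make the pieces compact. The radius \<open>e / 4\<close> here and
    \<open>e / 2\<close> in \<open>B\<close> add up to less than \<open>e\<close>.\<close>
  define P where "P t = {x \<in> K. f x \<in> cball t (e / 4)}" for t
  have P: "compactin X (P t)" for t
  proof -
    have "P t = K \<inter> {x \<in> topspace X. f x \<in> cball t (e / 4)}"
      using compactin_subset_topspace[OF K] by (auto simp: P_def)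
    moreover have "closedin X {x \<in> topspace X. f x \<in> cball t (e / 4)}"
      by (rule closedin_continuous_map_preimage[OF cf]) auto
    ultimately show ?thesis
      using K by (metis Int_commute closed_Int_compactin)
  qed
  define B where "B t = {h \<in> continuous_funs X. h ` P t \<subseteq> ball t (e / 2)}" for t
  \<comment> \<open>The factor \<open>continuous_funs X\<close> matters when \<open>T\<close> is
    empty, since the intersection is then the whole type.\<close>
  define A where "A = continuous_funs X \<inter> (\<Inter>t\<in>T. B t)"
  have "openin (compact_open_topology X) (B t)" for t
    unfolding B_def compact_open_topology_def
    by (rule topology_generated_by_Basis) (use P in auto)
  then have "openin (compact_open_topology X) A"
    using T openin_topspace[of "compact_open_topology X"]
    unfolding A_def topspace_compact_open_topology
    by (cases "T = {}") (auto intro!: openin_Int openin_INT2)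
  moreover have "f \<in> A"
    using f e by (fastforce simp: A_def B_def P_def)
  moreover have "A \<subseteq> unif_nbhd X f K e"
  proof
    fix h assume h: "h \<in> A"
    have "\<bar>h x - f x\<bar> < e" if x: "x \<in> K" for x
    proof -
      obtain t where t: "t \<in> T" "dist t (f x) < e / 4"
        using T x by auto
      then have "x \<in> P t"
        using x by (auto simp: P_def)
      then have "h x \<in> ball t (e / 2)"
        using h t(1) unfolding A_def B_def by blast
      then show ?thesis
        using t(2) unfolding mem_ball dist_real_def by linarith
    qed
    then show "h \<in> unif_nbhd X f K e"
      using h by (auto simp: A_def unif_nbhd_def)
  qed
  ultimately show thesis
    using that by blast
qed

lemma dense_in_compact_open_topology_iff:
  "compact_open_topology X closure_of S = topspace (compact_open_topology X) \<longleftrightarrow>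
     (\<forall>f K e. f \<in> continuous_funs X \<and> compactin X K \<and> e > 0 \<longrightarrow> S \<inter> unif_nbhd X f K e \<noteq> {})"
    (is "?l \<longleftrightarrow> ?r")
proof
  assume ?l
  then show ?r
    unfolding dense_intersects_open using open_subset_unif_nbhd
    by (smt (verit, best) disjoint_iff empty_iff in_mono)
next
  assume r: ?r
  show ?l
    unfolding dense_intersects_open
  proof (intro allI impI)
    fix A assume A: "openin (compact_open_topology X) A \<and> A \<noteq> {}"
    then obtain f where f: "f \<in> A"
      by auto
    then have "f \<in> continuous_funs X"
      using A openin_subset topspace_compact_open_topology by blast
    moreover obtain K e where "compactin X K" "e > 0" "unif_nbhd X f K e \<subseteq> A"
      using unif_nbhd_subset_open A f by blast
    ultimately show "S \<inter> A \<noteq> {}"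
      using r by blast
  qed
qed

section \<open>Strongly discrete families and compact sets\<close>

lemma strongly_discrete_family_finite_compact:
  assumes "strongly_discrete_family X \<G>" "compactin X K"
  shows "finite {F \<in> \<G>. F \<inter> K \<noteq> {}}"
proof -
  obtain V where V: "\<And>F. F \<in> \<G> \<Longrightarrow> F \<subseteq> V F"
    and W: "\<And>x. x \<in> topspace X \<Longrightarrow> \<exists>W. openin X W \<and> x \<in> W \<and>
           (\<forall>F\<in>\<G>. \<forall>G\<in>\<G>. W \<inter> V F \<noteq> {} \<and> W \<inter> V G \<noteq> {} \<longrightarrow> F = G)"
    using assms(1) unfolding strongly_discrete_family_def by metis
  define \<U> where "\<U> = {W. openin X W \<and>
           (\<forall>F\<in>\<G>. \<forall>G\<in>\<G>. W \<inter> V F \<noteq> {} \<and> W \<inter> V G \<noteq> {} \<longrightarrow> F = G)}"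
  have "K \<subseteq> \<Union>\<U>"
  proof
    fix x assume "x \<in> K"
    then have "x \<in> topspace X"
      using compactin_subset_topspace[OF assms(2)] by blast
    then obtain W where "W \<in> \<U>" "x \<in> W"
      using W unfolding \<U>_def mem_Collect_eq by metis
    then show "x \<in> \<Union>\<U>"
      by blast
  qed
  moreover have "openin X W" if "W \<in> \<U>" for W
    using that by (simp add: \<U>_def)
  ultimately obtain \<W> where \<W>: "finite \<W>" "\<W> \<subseteq> \<U>" "K \<subseteq> \<Union>\<W>"
    using compactinD[OF assms(2), of \<U>] by metis
  have "finite {F \<in> \<G>. W \<inter> V F \<noteq> {}}" if "W \<in> \<W>" for W
  proof (cases "\<exists>F0\<in>\<G>. W \<inter> V F0 \<noteq> {}")
    case True
    then obtain F0 where "F0 \<in> \<G>" "W \<inter> V F0 \<noteq> {}" by blast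
    then have "{F \<in> \<G>. W \<inter> V F \<noteq> {}} \<subseteq> {F0}"
      using that \<W>(2) by (fastforce simp: \<U>_def)
    then show ?thesis
      by (rule finite_subset) simp
  next
    case False
    then have "{F \<in> \<G>. W \<inter> V F \<noteq> {}} = {}"
      by blast
    then show ?thesis
      by (simp only: finite.emptyI)
  qed
  then have "finite (\<Union>W\<in>\<W>. {F \<in> \<G>. W \<inter> V F \<noteq> {}})"
    by (rule finite_UN_I[OF \<W>(1)])
  moreover have "{F \<in> \<G>. F \<inter> K \<noteq> {}} \<subseteq> (\<Union>W\<in>\<W>. {F \<in> \<G>. W \<inter> V F \<noteq> {}})"
  proof (rule subsetI, elim CollectE conjE)
    fix F assume "F \<in> \<G>" "F \<inter> K \<noteq> {}"
    then obtain x where "x \<in> F" "x \<in> K"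
      by blast
    moreover obtain W where "W \<in> \<W>" "x \<in> W"
      using \<W>(3) \<open>x \<in> K\<close> by blast
    moreover have "x \<in> V F"
      using V \<open>F \<in> \<G>\<close> \<open>x \<in> F\<close> by blast
    ultimately show "F \<in> (\<Union>W\<in>\<W>. {F \<in> \<G>. W \<inter> V F \<noteq> {}})"
      using \<open>F \<in> \<G>\<close> by blast
  qed
  ultimately show ?thesis
    by (rule finite_subset[rotated])
qed

subsection \<open>Strategies for moving off compact sets\<close>

text \<open>A compact set meets only finitely many members of a strongly discrete family, so any
  injective sequence of its members eventually avoids that set.\<close>

lemma moving_off_property_sequence:
  assumes "moving_off_property X" "moving_off_family X \<F>" "\<And>F. F \<in> \<F> \<Longrightarrow> compactin X F"
  shows "\<exists>E :: nat \<Rightarrow> 'a set. range E \<subseteq> \<F> \<and> (\<forall>K. compactin X K \<longrightarrow> (\<exists>i. E i \<inter> K = {}))"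
proof -
  obtain \<G> where \<G>: "\<G> \<subseteq> \<F>" "infinite \<G>" "strongly_discrete_family X \<G>"
    using assms unfolding moving_off_property_def by metis
  then obtain E :: "nat \<Rightarrow> 'a set" where E: "inj E" "range E \<subseteq> \<G>"
    using infinite_countable_subset by metis
  have "\<exists>i. E i \<inter> K = {}" if "compactin X K" for K
  proof (rule ccontr)
    assume "\<not> (\<exists>i. E i \<inter> K = {})"
    then have "range E \<subseteq> {F \<in> \<G>. F \<inter> K \<noteq> {}}"
      using E(2) by auto
    then have "finite (range E)"
      using strongly_discrete_family_finite_compact[OF \<G>(3) that] finite_subset by blast
    then show False
      using E(1) range_inj_infinite by blast
  qed
  then show ?thesis
    using E(2) \<G>(1) by blast
qed

text \<open>A game in which \<open>K\<close> is a challenge, \<open>L\<close> the reply and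
  \<open>P\<close> what the reply achieves. Countably many challenges per position suffice, so
  positions can be coded by lists of naturals. Sets that collect replies from many positions form a
  moving off family, and the run is chosen so that its replies lie in distinct members of a strongly
  discrete subfamily.\<close>

lemma compact_strategy_locally_finite_run:
  fixes P :: "'s \<Rightarrow> 'a set \<Rightarrow> 's \<Rightarrow> bool"
  assumes mop: "moving_off_property X"
    and I0: "I s0"
    and step: "\<And>s K. I s \<Longrightarrow> compactin X K \<Longrightarrow> \<exists>L s'. compactin X L \<and> K \<inter> L = {} \<and> P s L s' \<and> I s'"
  obtains \<sigma> :: "nat \<Rightarrow> 's" and \<Lambda> :: "nat \<Rightarrow> 'a set" where
    "\<sigma> 0 = s0" "\<And>m. I (\<sigma> m)" "\<And>m. P (\<sigma> m) (\<Lambda> m) (\<sigma> (Suc m))"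
    "\<And>x. x \<in> topspace X \<Longrightarrow> \<exists>W. openin X W \<and> x \<in> W \<and> finite {m. W \<inter> \<Lambda> m \<noteq> {}}"
proof -
  obtain lab nxt where lab: "\<And>s K. I s \<Longrightarrow> compactin X K \<Longrightarrow>
      compactin X (lab s K) \<and> K \<inter> lab s K = {} \<and> P s (lab s K) (nxt s K) \<and> I (nxt s K)"
    using step by metis
  show thesis
  proof (cases "compactin X (topspace X)")
    case True
    \<comment> \<open>Challenging with the whole space forces every reply to be empty.\<close>
    define \<sigma> where "\<sigma> m = ((\<lambda>s. nxt s (topspace X)) ^^ m) s0" for m
    have I: "I (\<sigma> m)" for m
      by (induction m) (auto simp: \<sigma>_def I0 lab True)
    have empty: "lab (\<sigma> m) (topspace X) = {}" for m
      using lab[OF I[of m] True] compactin_subset_topspace by fastforce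
    show thesis
    proof (rule that[of \<sigma> "\<lambda>m. lab (\<sigma> m) (topspace X)"])
      show "P (\<sigma> m) (lab (\<sigma> m) (topspace X)) (\<sigma> (Suc m))" for m
        using lab[OF I[of m] True] by (simp add: \<sigma>_def)
      show "\<exists>W. openin X W \<and> x \<in> W \<and> finite {m. W \<inter> lab (\<sigma> m) (topspace X) \<noteq> {}}"
        if "x \<in> topspace X" for x
        using that unfolding empty by (intro exI[of _ "topspace X"]) auto
    qed (use I in \<open>auto simp: \<sigma>_def\<close>)
  next
    case False
    have "\<exists>x. x \<in> topspace X - K" if "compactin X K" for K
      using that False by (metis DiffI compactin_subset_topspace subsetI subset_antisym)
    then obtain pt where pt: "\<And>K. compactin X K \<Longrightarrow> pt K \<in> topspace X - K"
      by metis
    \<comment> \<open>A moving off family has to offer non-empty members, so a point outside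
      \<open>K\<close> is added to the reply. The run returned at the end uses \<open>lab\<close>
      again.\<close>
    define lab' where "lab' s K = insert (pt K) (lab s K)" for s K
    have lab': "compactin X (lab' s K)" "K \<inter> lab' s K = {}" "lab' s K \<noteq> {}"
      if "I s" "compactin X K" for s K
      using lab[OF that] pt[OF that(2)] compactin_Un[of X "{pt K}" "lab s K"]
      by (auto simp: lab'_def)
    \<comment> \<open>Pruning: only the challenges \<open>\<kappa> s i\<close> are kept at
      \<open>s\<close>, and their replies still suffice to avoid every compact set.\<close>
    have "\<exists>\<kappa> :: nat \<Rightarrow> 'a set. (\<forall>i. compactin X (\<kappa> i)) \<and>
            (\<forall>K. compactin X K \<longrightarrow> (\<exists>i. lab' s (\<kappa> i) \<inter> K = {}))" if s: "I s" for s
    proof -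
      let ?F = "lab' s ` {K. compactin X K}"
      have "moving_off_family X ?F"
        unfolding moving_off_family_def
      proof (intro conjI ballI allI impI)
        show "F \<subseteq> topspace X" if "F \<in> ?F" for F
          using that lab'(1)[OF s] compactin_subset_topspace by blast
        show "\<exists>F\<in>?F. F \<noteq> {} \<and> K \<inter> F = {}" if "compactin X K" for K
          using that lab'(2,3)[OF s that] by (intro bexI[of _ "lab' s K"]) auto
      qed
      moreover have "compactin X F" if "F \<in> ?F" for F
        using that lab'(1)[OF s] by blast
      ultimately have "\<exists>E :: nat \<Rightarrow> 'a set. range E \<subseteq> ?F \<and> (\<forall>K. compactin X K \<longrightarrow> (\<exists>i. E i \<inter> K = {}))"
        by (rule moving_off_property_sequence[OF mop])
      then obtain E :: "nat \<Rightarrow> 'a set" where E: "range E \<subseteq> ?F"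
        "\<And>K. compactin X K \<Longrightarrow> \<exists>i. E i \<inter> K = {}"
        by metis
      have "\<forall>i. \<exists>K. compactin X K \<and> E i = lab' s K"
        using E(1) by blast
      then obtain \<kappa> where \<kappa>: "\<And>i. compactin X (\<kappa> i)" "\<And>i. E i = lab' s (\<kappa> i)"
        by metis
      then have "E = (\<lambda>i. lab' s (\<kappa> i))"
        by auto
      then show ?thesis
        using E \<kappa>(1) by auto
    qed
    then obtain \<kappa> :: "'s \<Rightarrow> nat \<Rightarrow> 'a set" where \<kappa>: "\<And>s i. I s \<Longrightarrow> compactin X (\<kappa> s i)"
      and avoid: "\<And>s K. I s \<Longrightarrow> compactin X K \<Longrightarrow> \<exists>i. lab' s (\<kappa> s i) \<inter> K = {}"
      by metis
    define e where "e s i = lab' s (\<kappa> s i)" for s i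
    obtain a where a: "\<And>s K. I s \<Longrightarrow> compactin X K \<Longrightarrow> e s (a s K) \<inter> K = {}"
      using avoid unfolding e_def by metis
    \<comment> \<open>\<open>\<rho> l s0\<close> is the position reached by the challenges indexed
      by \<open>l\<close>, the most recent one at the head of the list.\<close>
    define \<rho> where "\<rho> = foldr (\<lambda>i s. nxt s (\<kappa> s i))"
    have I\<rho>: "I (\<rho> l s0)" for l
      by (induction l) (auto simp: \<rho>_def I0 lab \<kappa>)
    \<comment> \<open>The index chosen at the root also fixes how many coded positions contribute a
      reply. Each \<open>\<Phi> K\<close> is thus a finite union, but one with a large root index
      serves many positions.\<close>
    define \<Phi> where "\<Phi> K = e s0 (a s0 K) \<union>
        (\<Union>j<a s0 K. e (\<rho> (from_nat j) s0) (a (\<rho> (from_nat j) s0) K))" for K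
    have ecomp: "compactin X (e s i)" if "I s" for s i
      using lab'(1)[OF that \<kappa>[OF that]] by (simp add: e_def)
    have ene: "e s i \<noteq> {}" if "I s" for s i
      using lab'(3)[OF that \<kappa>[OF that]] by (simp add: e_def)
    have \<Phi>comp: "compactin X (\<Phi> K)" for K
      unfolding \<Phi>_def using I0 I\<rho> ecomp
      by (intro compactin_Un compactin_Union) auto
    have \<Phi>disj: "\<Phi> K \<inter> K = {}" if "compactin X K" for K
      using a[OF I0 that] a[OF I\<rho> that] unfolding \<Phi>_def by blast
    have \<Phi>ne: "\<Phi> K \<noteq> {}" for K
      using ene[OF I0] unfolding \<Phi>_def by blast
    have "moving_off_family X (\<Phi> ` {K. compactin X K})"
      unfolding moving_off_family_def
    proof (intro conjI ballI allI impI)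
      show "F \<subseteq> topspace X" if "F \<in> \<Phi> ` {K. compactin X K}" for F
        using that \<Phi>comp compactin_subset_topspace by blast
      show "\<exists>F\<in>\<Phi> ` {K. compactin X K}. F \<noteq> {} \<and> K \<inter> F = {}" if "compactin X K" for K
        using that \<Phi>disj \<Phi>ne by (intro bexI[of _ "\<Phi> K"]) auto
    qed
    then obtain \<G> where \<G>: "\<G> \<subseteq> \<Phi> ` {K. compactin X K}" "infinite \<G>" "strongly_discrete_family X \<G>"
      using mop \<Phi>comp unfolding moving_off_property_def by (metis (no_types, lifting) image_iff)
    have "\<forall>F\<in>\<G>. \<exists>K. compactin X K \<and> F = \<Phi> K"
      using \<G>(1) by blast
    then obtain k where k: "\<And>F. F \<in> \<G> \<Longrightarrow> compactin X (k F)" "\<And>F. F \<in> \<G> \<Longrightarrow> F = \<Phi> (k F)"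
      by metis
    obtain V where V: "\<And>F. F \<in> \<G> \<Longrightarrow> F \<subseteq> V F"
      and W: "\<And>x. x \<in> topspace X \<Longrightarrow> \<exists>W. openin X W \<and> x \<in> W \<and>
             (\<forall>F\<in>\<G>. \<forall>G\<in>\<G>. W \<inter> V F \<noteq> {} \<and> W \<inter> V G \<noteq> {} \<longrightarrow> F = G)"
      using \<G>(3) unfolding strongly_discrete_family_def by metis
    define n where "n F = a s0 (k F)" for F
    \<comment> \<open>Members with the same root index share the non-empty root reply, which strong
      discreteness excludes for distinct members. Injectivity on the infinite \<open>\<G>\<close>
      makes \<open>n\<close> unbounded.\<close>
    have "inj_on n \<G>"
    proof (rule inj_onI)
      fix F G assume FG: "F \<in> \<G>" "G \<in> \<G>" "n F = n G"
      obtain x where x: "x \<in> e s0 (n F)"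
        using ene[OF I0] by blast
      then have "x \<in> F" "x \<in> G"
        using k(2)[OF FG(1)] k(2)[OF FG(2)] FG(3) unfolding n_def \<Phi>_def by auto
      moreover have "x \<in> topspace X"
        using x ecomp[OF I0] compactin_subset_topspace by blast
      moreover from \<open>x \<in> topspace X\<close> obtain W0 where W0: "x \<in> W0"
          "\<forall>F\<in>\<G>. \<forall>G\<in>\<G>. W0 \<inter> V F \<noteq> {} \<and> W0 \<inter> V G \<noteq> {} \<longrightarrow> F = G"
        using W by blast
      ultimately have "W0 \<inter> V F \<noteq> {}" "W0 \<inter> V G \<noteq> {}"
        using V[OF FG(1)] V[OF FG(2)] by blast+
      then show "F = G"
        using W0(2) FG(1,2) by metis
    qed
    then have "infinite (n ` \<G>)"
      using \<G>(2) finite_image_iff by blast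
    then have big: "\<exists>F\<in>\<G>. n F > m" for m
      using infinite_nat_iff_unbounded by (metis (no_types, lifting) image_iff)
    \<comment> \<open>Member \<open>F\<close> contains a move from each of the first \<open>n F\<close> nodes, so a branch can be read off
      from members with fast growing \<open>n\<close>.\<close>
    have "\<exists>q :: nat \<Rightarrow> nat list \<times> 'a set. \<forall>m. (snd (q m) \<in> \<G> \<and> to_nat (fst (q m)) < n (snd (q m)) \<and> (m = 0 \<longrightarrow> fst (q m) = []))
       \<and> (fst (q (Suc m)) = a (\<rho> (fst (q m)) s0) (k (snd (q m))) # fst (q m) \<and> n (snd (q m)) < n (snd (q (Suc m))))"
    proof (rule dependent_nat_choice)
      show "\<exists>x :: nat list \<times> 'a set. snd x \<in> \<G> \<and> to_nat (fst x) < n (snd x) \<and> (0 = (0::nat) \<longrightarrow> fst x = [])"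
        using big[of "to_nat ([] :: nat list)"] by auto
    next
      fix x :: "nat list \<times> 'a set" and m :: nat
      let ?l = "a (\<rho> (fst x) s0) (k (snd x)) # fst x"
      obtain F where "F \<in> \<G>" "n F > max (to_nat ?l) (n (snd x))"
        using big by blast
      then show "\<exists>y. (snd y \<in> \<G> \<and> to_nat (fst y) < n (snd y) \<and> (Suc m = 0 \<longrightarrow> fst y = [])) \<and>
            fst y = ?l \<and> n (snd x) < n (snd y)"
        by (intro exI[of _ "(?l, F)"]) auto
    qed
    then obtain q :: "nat \<Rightarrow> nat list \<times> 'a set" where q:
        "\<And>m. snd (q m) \<in> \<G>" "\<And>m. to_nat (fst (q m)) < n (snd (q m))" "fst (q 0) = []"
        "\<And>m. fst (q (Suc m)) = a (\<rho> (fst (q m)) s0) (k (snd (q m))) # fst (q m)"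
        "\<And>m. n (snd (q m)) < n (snd (q (Suc m)))"
      by blast
    define \<sigma> where "\<sigma> m = \<rho> (fst (q m)) s0" for m
    define \<K> where "\<K> m = \<kappa> (\<sigma> m) (a (\<sigma> m) (k (snd (q m))))" for m
    have I\<sigma>: "I (\<sigma> m)" for m
      by (simp add: \<sigma>_def I\<rho>)
    have \<K>: "compactin X (\<K> m)" for m
      by (simp add: \<K>_def \<kappa> I\<sigma>)
    \<comment> \<open>The code of the current position is below \<open>n (snd (q m))\<close>, so its
      reply was included in that member.\<close>
    have sub: "lab (\<sigma> m) (\<K> m) \<subseteq> snd (q m)" for m
    proof -
      have "lab (\<sigma> m) (\<K> m) \<subseteq> e (\<sigma> m) (a (\<sigma> m) (k (snd (q m))))"
        by (auto simp: e_def lab'_def \<K>_def)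
      also have "\<dots> \<subseteq> \<Phi> (k (snd (q m)))"
        using q(2)[of m] unfolding \<Phi>_def \<sigma>_def n_def by (force intro!: UN_I[of "to_nat (fst (q m))"])
      finally show ?thesis
        using k(2)[OF q(1)[of m]] by simp
    qed
    \<comment> \<open>Growth of \<open>n\<close> makes the chosen members distinct, so a
      neighbourhood meeting at most one \<open>V F\<close> meets at most one reply.\<close>
    have "strict_mono (\<lambda>m. n (snd (q m)))"
      using q(5) by (simp add: strict_mono_Suc_iff)
    then have injq: "i = j" if "snd (q i) = snd (q j)" for i j
      using that by (metis strict_mono_eq)
    show thesis
    proof (rule that[of \<sigma> "\<lambda>m. lab (\<sigma> m) (\<K> m)"])
      show "\<sigma> 0 = s0"
        by (simp add: \<sigma>_def q(3) \<rho>_def)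
      show "I (\<sigma> m)" for m
        by (rule I\<sigma>)
      have "\<sigma> (Suc m) = nxt (\<sigma> m) (\<K> m)" for m
        unfolding \<K>_def unfolding \<sigma>_def q(4) by (simp add: \<rho>_def)
      then show "P (\<sigma> m) (lab (\<sigma> m) (\<K> m)) (\<sigma> (Suc m))" for m
        using lab[OF I\<sigma> \<K>] by simp
      fix x assume "x \<in> topspace X"
      then obtain W0 where W0: "openin X W0" "x \<in> W0"
         "\<forall>F\<in>\<G>. \<forall>G\<in>\<G>. W0 \<inter> V F \<noteq> {} \<and> W0 \<inter> V G \<noteq> {} \<longrightarrow> F = G"
        using W by metis
      have meets: "W0 \<inter> V (snd (q m)) \<noteq> {}" if "W0 \<inter> lab (\<sigma> m) (\<K> m) \<noteq> {}" for m
        using that sub[of m] V[OF q(1)[of m]] by blast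
      have same: "i = j" if "W0 \<inter> lab (\<sigma> i) (\<K> i) \<noteq> {}" "W0 \<inter> lab (\<sigma> j) (\<K> j) \<noteq> {}" for i j
        using W0(3)[rule_format, OF q(1)[of i] q(1)[of j]] meets[OF that(1)] meets[OF that(2)]
        by (intro injq) simp
      have "finite {m. W0 \<inter> lab (\<sigma> m) (\<K> m) \<noteq> {}}"
      proof (cases "\<exists>i. W0 \<inter> lab (\<sigma> i) (\<K> i) \<noteq> {}")
        case True
        then obtain i where "W0 \<inter> lab (\<sigma> i) (\<K> i) \<noteq> {}"
          by blast
        with same have "{m. W0 \<inter> lab (\<sigma> m) (\<K> m) \<noteq> {}} \<subseteq> {i}"
          by blast
        then show ?thesis
          by (rule finite_subset) simp
      qed simp
      then show "\<exists>W. openin X W \<and> x \<in> W \<and> finite {m. W \<inter> lab (\<sigma> m) (\<K> m) \<noteq> {}}"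
        using W0 by blast
    qed
  qed
qed

subsection \<open>From the Baire property to the Moving Off Property\<close>

text \<open>Normality gives density of the sets \<open>G n\<close> through Urysohn functions.
  Compactness bounds a generic \<open>f\<close> on each member, so members can be picked whose
  values lie in intervals separated by gaps; preimages of these intervals are the required
  neighbourhoods.\<close>

lemma baire_imp_moving_off_property:
  fixes X :: "'a topology"
  assumes haus: "Hausdorff_space X" and normal: "normal_space X"
    and baire: "baire_space (compact_open_topology X)"
  shows "moving_off_property X"
  unfolding moving_off_property_def
proof (intro allI impI, elim conjE)
  fix \<F> :: "'a set set"
  assume comp: "\<forall>F\<in>\<F>. compactin X F" and off: "moving_off_family X \<F>"
  define G where "G n = (\<Union>F\<in>{F \<in> \<F>. F \<noteq> {}}. {f \<in> continuous_funs X. f ` F \<subseteq> {real n<..}})" for n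
  have "openin (compact_open_topology X) (G n)" for n
    unfolding G_def
  proof (rule openin_Union, elim imageE CollectE conjE, hypsubst)
    fix F assume "F \<in> \<F>"
    then show "openin (compact_open_topology X) {f \<in> continuous_funs X. f ` F \<subseteq> {real n<..}}"
      unfolding compact_open_topology_def using comp
      by (intro topology_generated_by_Basis CollectI exI[of _ F] exI[of _ "{real n<..}"]) auto
  qed
  moreover have "compact_open_topology X closure_of (G n) = topspace (compact_open_topology X)" for n
    unfolding dense_in_compact_open_topology_iff
  proof (intro allI impI, elim conjE)
    fix f K and e :: real
    assume f: "f \<in> continuous_funs X" and K: "compactin X K" and e: "0 < e"
    obtain F where F: "F \<in> \<F>" "F \<noteq> {}" "K \<inter> F = {}"
      using off K unfolding moving_off_family_def by blast
    have cf: "continuous_map X euclideanreal f"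
      using f by (simp add: continuous_funs_def)
    have "closedin X K" "closedin X F" "disjnt K F"
      using haus K F comp compactin_imp_closedin by (auto simp: disjnt_def)
    then obtain \<phi> where \<phi>: "continuous_map X euclideanreal \<phi>" "\<phi> ` K \<subseteq> {0::real}" "\<phi> ` F \<subseteq> {1}"
      using Urysohn_lemma_alt[OF normal] by metis
    \<comment> \<open>\<open>\<phi>\<close> interpolates between \<open>f\<close> on
      \<open>K\<close> and the constant \<open>n + 1\<close> on \<open>F\<close>.\<close>
    define h where "h = restrict (\<lambda>x. f x + \<phi> x * (real n + 1 - f x)) (topspace X)"
    have "h \<in> continuous_funs X"
      unfolding h_def
      by (intro restrict_in_continuous_funs continuous_intros cf \<phi>)
    moreover have "h x = f x" if "x \<in> K" for x
    proof -
      have "\<phi> x = 0" "x \<in> topspace X"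
        using that \<phi>(2) compactin_subset_topspace[OF K] by auto
      then show ?thesis
        by (simp add: h_def)
    qed
    moreover have "h x = real n + 1" if "x \<in> F" for x
    proof -
      have "\<phi> x = 1" "x \<in> topspace X"
        using that \<phi>(3) compactin_subset_topspace comp F(1) by auto
      then show ?thesis
        by (simp add: h_def)
    qed
    ultimately have "h \<in> G n \<inter> unif_nbhd X f K e"
      using F e unfolding G_def unif_nbhd_def by auto
    then show "G n \<inter> unif_nbhd X f K e \<noteq> {}"
      by blast
  qed
  ultimately have dense: "compact_open_topology X closure_of (\<Inter>n. G n) = topspace (compact_open_topology X)"
    using baire unfolding baire_space_def by blast
  have "restrict (\<lambda>_. 0) (topspace X) \<in> continuous_funs X"
    by (intro restrict_in_continuous_funs) simp
  then have "(\<Inter>n. G n) \<inter> unif_nbhd X (restrict (\<lambda>_. 0) (topspace X)) {} 1 \<noteq> {}"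
    using dense unfolding dense_in_compact_open_topology_iff by simp
  then obtain f where f: "\<And>n. f \<in> G n"
    by blast
  have cf: "continuous_map X euclideanreal f"
    using f[of 0] by (auto simp: G_def continuous_funs_def)
  have "\<forall>n. \<exists>F. F \<in> \<F> \<and> F \<noteq> {} \<and> (\<forall>x\<in>F. f x > real n)"
    using f unfolding G_def by blast
  then obtain F where F: "\<And>n. F n \<in> \<F>" "\<And>n. F n \<noteq> {}" "\<And>n x. x \<in> F n \<Longrightarrow> f x > real n"
    by metis
  have "\<exists>b. \<forall>x\<in>F n. f x < real b" for n
  proof -
    have "compact (f ` F n)"
      using image_compactin[OF _ cf] comp F(1) compactin_euclidean_iff by blast
    then obtain B where "\<forall>y\<in>f ` F n. norm y \<le> B"
      using compact_imp_bounded bounded_iff by metis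
    then have "\<And>x. x \<in> F n \<Longrightarrow> \<bar>f x\<bar> \<le> B"
      by simp
    moreover obtain b :: nat where "B < real b"
      using reals_Archimedean2 by blast
    ultimately show ?thesis
      by (intro exI[of _ b]) force
  qed
  then obtain b :: "nat \<Rightarrow> nat" where b: "\<And>n x. x \<in> F n \<Longrightarrow> f x < real (b n)"
    by metis
  \<comment> \<open>The next threshold is one more than a bound for \<open>f\<close> on the current
    member, which leaves a gap of length at least 1 between value intervals.\<close>
  define m where "m i = ((\<lambda>n. Suc (b n)) ^^ i) 0" for i
  have m_Suc: "m (Suc i) = Suc (b (m i))" for i
    by (simp add: m_def)
  have "m i < m (Suc i)" for i
    unfolding m_Suc using F(2)[of "m i"] F(3)[of _ "m i"] b[of _ "m i"]
    by (metis ex_in_conv less_Suc_eq of_nat_less_iff order_less_trans)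
  then have mono: "mono m"
    by (simp add: mono_iff_le_Suc less_imp_le)
  define V where "V i = {x \<in> topspace X. f x \<in> {real (m i)<..<real (b (m i))}}" for i
  have V: "openin X (V i)" for i
    unfolding V_def by (rule openin_continuous_map_preimage[OF cf]) auto
  have FV: "F (m i) \<subseteq> V i" for i
    using F(1)[of "m i"] F(3)[of _ "m i"] b[of _ "m i"] comp compactin_subset_topspace
    unfolding V_def by fastforce
  have gap: "f x + 1 < f y" if "i < j" "x \<in> V i" "y \<in> V j" for i j x y
  proof -
    have "Suc (b (m i)) \<le> m j"
      using monoD[OF mono, of "Suc i" j] that(1) by (simp add: m_Suc)
    then have "real (b (m i)) + 1 \<le> real (m j)"
      by linarith
    moreover have "f x < real (b (m i))" "real (m j) < f y"
      using that(2,3) by (auto simp: V_def)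
    ultimately show ?thesis
      by linarith
  qed
  define E where "E i = F (m i)" for i
  have "inj E"
  proof (rule injI)
    fix i j assume "E i = E j"
    then obtain x where "x \<in> V i" "x \<in> V j"
      using F(2)[of "m i"] FV[of i] FV[of j] unfolding E_def by blast
    then show "i = j"
      using gap[of i j x x] gap[of j i x x] by (cases i j rule: linorder_cases) auto
  qed
  have "strongly_discrete_family X (range E)"
    unfolding strongly_discrete_family_def
  \<comment> \<open>Neighbourhoods are indexed by members, not by numbers; injectivity of
    \<open>E\<close> lets \<open>inv E\<close> translate.\<close>
  proof (intro exI[of _ "\<lambda>A. V (inv E A)"] conjI ballI)
    show "openin X (V (inv E A))" for A
      by (rule V)
    show "A \<subseteq> V (inv E A)" if "A \<in> range E" for A
      using that FV \<open>inj E\<close> by (auto simp: E_def[symmetric] subset_iff)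
    fix x assume x: "x \<in> topspace X"
    define W where "W = {y \<in> topspace X. f y \<in> ball (f x) (1 / 2)}"
    have "i = j" if "W \<inter> V i \<noteq> {}" "W \<inter> V j \<noteq> {}" for i j
    proof -
      obtain y z where yz: "y \<in> W" "y \<in> V i" "z \<in> W" "z \<in> V j"
        using \<open>W \<inter> V i \<noteq> {}\<close> \<open>W \<inter> V j \<noteq> {}\<close> by blast
      then have "\<bar>f y - f x\<bar> < 1 / 2" "\<bar>f z - f x\<bar> < 1 / 2"
        by (auto simp: W_def dist_real_def abs_minus_commute)
      then have "\<not> f y + 1 < f z" "\<not> f z + 1 < f y"
        by linarith+
      then show ?thesis
        using gap yz by (metis linorder_less_linear)
    qed
    then have "\<forall>A\<in>range E. \<forall>B\<in>range E. W \<inter> V (inv E A) \<noteq> {} \<and> W \<inter> V (inv E B) \<noteq> {} \<longrightarrow> A = B"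
      by (metis f_inv_into_f)
    moreover have "openin X W"
      unfolding W_def by (rule openin_continuous_map_preimage[OF cf]) auto
    ultimately show "\<exists>W. openin X W \<and> x \<in> W \<and> (\<forall>A\<in>range E. \<forall>B\<in>range E.
        W \<inter> V (inv E A) \<noteq> {} \<and> W \<inter> V (inv E B) \<noteq> {} \<longrightarrow> A = B)"
      using x by (intro exI[of _ W]) (auto simp: W_def)
  qed
  moreover have "range E \<subseteq> \<F>"
    using F(1) by (auto simp: E_def)
  moreover have "infinite (range E)"
    using \<open>inj E\<close> by (rule range_inj_infinite)
  ultimately show "\<exists>\<G>\<subseteq>\<F>. infinite \<G> \<and> strongly_discrete_family X \<G>"
    by blast
qed

subsection \<open>Towers of retractions\<close>

text \<open>\<open>r k\<close> retracts \<open>X\<close> onto its \<open>k\<close>-th derivative, and the \<open>n\<close>-th derivative is empty.  A fixed point of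
  \<open>r k\<close> that \<open>r (Suc k)\<close> moves, or any fixed point if \<open>k = n - 1\<close>, is isolated in the \<open>k\<close>-th derivative.\<close>

locale retraction_tower =
  fixes X :: "'a topology" and n :: nat and r :: "nat \<Rightarrow> 'a \<Rightarrow> 'a"
  assumes t1: "t1_space X"
    and height_pos: "x \<in> topspace X \<Longrightarrow> 0 < n"
    and cont: "k < n \<Longrightarrow> continuous_map X X (r k)"
    and r_zero: "x \<in> topspace X \<Longrightarrow> r 0 x = x"
    and r_r: "\<lbrakk>i < n; j < n; x \<in> topspace X\<rbrakk> \<Longrightarrow> r i (r j x) = r (max i j) x"
    and fibre_open: "\<lbrakk>k < n; x \<in> topspace X; r k x = x; Suc k < n \<Longrightarrow> r (Suc k) x \<noteq> x\<rbrakk>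
                       \<Longrightarrow> openin X {y \<in> topspace X. r k y = x}"
begin

section \<open>Coefficients of a function along the tower\<close>

lemma r_in [simp]: "k < n \<Longrightarrow> x \<in> topspace X \<Longrightarrow> r k x \<in> topspace X"
  using cont unfolding continuous_map_def by blast

text \<open>The default 0 from \<open>n\<close> on ends the telescoping sum and makes the top
  coefficient the composite of \<open>g\<close> with the last retraction.\<close>

definition level :: "('a \<Rightarrow> real) \<Rightarrow> nat \<Rightarrow> 'a \<Rightarrow> real" where
  "level g k y = (if k < n then g (r k y) else 0)"

text \<open>The function \<open>coef g k\<close> factors through \<open>r k\<close> and vanishes on the derivative of order \<open>k + 1\<close>.\<close>

definition coef :: "('a \<Rightarrow> real) \<Rightarrow> nat \<Rightarrow> 'a \<Rightarrow> real" where
  "coef g k y = level g k y - level g (Suc k) y"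

text \<open>The sum telescopes to \<open>level g 0 y\<close>, which is \<open>g y\<close> because
  \<open>r 0\<close> is the identity and \<open>n\<close> is positive once a point exists.\<close>

lemma sum_coef:
  assumes "y \<in> topspace X"
  shows "(\<Sum>k<n. coef g k y) = g y"
proof -
  have "(\<Sum>k<n. coef g k y) = level g 0 y - level g n y"
    unfolding coef_def by (rule sum_lessThan_telescope')
  then show ?thesis
    using assms height_pos by (simp add: level_def r_zero)
qed

lemma coef_r:
  assumes "k < n" "y \<in> topspace X"
  shows "coef g k (r k y) = coef g k y"
  using assms by (simp add: coef_def level_def r_r max_def)

lemma continuous_coef:
  assumes "continuous_map X euclideanreal g"
  shows "continuous_map X euclideanreal (coef g k)"
proof -
  have "continuous_map X euclideanreal (level g k)" for k
    using continuous_map_compose[OF cont assms, of k] by (simp add: level_def[abs_def] o_def)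
  then show ?thesis
    unfolding coef_def[abs_def] by (intro continuous_map_diff)
qed

section \<open>Compact sets invariant under the retractions\<close>

definition saturation :: "'a set \<Rightarrow> 'a set" where
  "saturation K = (\<Union>k<n. r k ` K)"

definition invariant :: "'a set \<Rightarrow> bool" where
  "invariant K \<longleftrightarrow> (\<forall>k<n. r k ` K \<subseteq> K)"

text \<open>Finitely many continuous images keep the set compact, and the composition law
  \<open>r_r\<close> makes it invariant.\<close>

lemma saturation:
  assumes "compactin X K"
  shows "compactin X (saturation K)" "K \<subseteq> saturation K" "invariant (saturation K)"
proof -
  have K: "K \<subseteq> topspace X"
    using assms compactin_subset_topspace by blast
  show "compactin X (saturation K)"
    unfolding saturation_def using image_compactin[OF assms cont]
    by (intro compactin_Union) auto
  show "K \<subseteq> saturation K"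
  proof
    fix x assume x: "x \<in> K"
    then have "0 < n" "r 0 x = x"
      using K height_pos[of x] r_zero by auto
    then show "x \<in> saturation K"
      using x unfolding saturation_def by force
  qed
  show "invariant (saturation K)"
    unfolding invariant_def saturation_def
  proof (intro allI impI subsetI)
    fix k y assume k: "k < n" and "y \<in> r k ` (\<Union>i<n. r i ` K)"
    then obtain i x where i: "i < n" "x \<in> K" "y = r k (r i x)"
      by blast
    then have "y = r (max k i) x" "max k i < n"
      using K k r_r by auto
    then show "y \<in> (\<Union>i<n. r i ` K)"
      using i(2) by blast
  qed
qed

text \<open>By invariance a coefficient is a difference of two values of \<open>g\<close> on
  \<open>K\<close>, or a single one at the top level.\<close>

lemma abs_coef_less:
  assumes "k < n" "invariant K" "x \<in> K" "\<And>y. y \<in> K \<Longrightarrow> \<bar>g y\<bar> < \<delta>"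
  shows "\<bar>coef g k x\<bar> < 2 * \<delta>"
proof -
  have "\<bar>g (r k x)\<bar> < \<delta>" "0 < \<delta>"
    using assms unfolding invariant_def by (auto simp: image_subset_iff intro: le_less_trans[OF abs_ge_zero])
  moreover have "\<bar>g (r (Suc k) x)\<bar> < \<delta>" if "Suc k < n"
    using assms that unfolding invariant_def by (auto simp: image_subset_iff)
  ultimately show ?thesis
    unfolding coef_def level_def using assms(1) by auto
qed

text \<open>The coefficient is non-zero at a point of \<open>F\<close>, so the next retraction, if
  there is one, moves that point and its fibre is open. These disjoint fibres cover the compact set
  of large coefficients and each one meets it, so there are finitely many.\<close>

lemma finite_large_coef:
  assumes g: "continuous_map X euclideanreal g" and K: "compactin X K" and k: "k < n" and \<eta>: "\<eta> > 0"
  defines "F \<equiv> r k ` {y \<in> K. \<bar>coef g k y\<bar> \<ge> \<eta>}"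
  shows "finite F" "openin X {y \<in> topspace X. r k y \<in> F}" "closedin X {y \<in> topspace X. r k y \<in> F}"
proof -
  have Ktop: "K \<subseteq> topspace X"
    using K compactin_subset_topspace by blast
  define C where "C = {y \<in> K. \<bar>coef g k y\<bar> \<ge> \<eta>}"
  define fib where "fib x = {y \<in> topspace X. r k y = x}" for x
  have "closedin X {y \<in> topspace X. \<bar>coef g k y\<bar> \<in> {\<eta>..}}"
    by (rule closedin_continuous_map_preimage[of _ euclideanreal])
       (intro continuous_map_real_abs continuous_coef g, simp)
  moreover have "C = {y \<in> topspace X. \<bar>coef g k y\<bar> \<in> {\<eta>..}} \<inter> K"
    using Ktop by (auto simp: C_def)
  ultimately have C: "compactin X C"
    using K closed_Int_compactin by metis
  have fib_open: "openin X (fib x)" if x: "x \<in> F" for x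
  proof -
    obtain y where y: "y \<in> C" "x = r k y"
      using x by (auto simp: F_def C_def)
    then have ytop: "y \<in> topspace X" and "\<bar>coef g k y\<bar> \<ge> \<eta>"
      using Ktop by (auto simp: C_def)
    then have "coef g k x \<noteq> 0"
      using y \<eta> coef_r[OF k ytop] by auto
    moreover have rx: "r k x = x"
      using y k ytop by (simp add: r_r)
    ultimately have "r (Suc k) x \<noteq> x" if "Suc k < n"
      using that k by (auto simp: coef_def level_def)
    then show ?thesis
      unfolding fib_def using fibre_open[OF k _ rx] y k ytop by simp
  qed
  have "\<exists>\<W>. finite \<W> \<and> \<W> \<subseteq> fib ` F \<and> C \<subseteq> \<Union>\<W>"
  proof (rule compactinD[OF C])
    show "C \<subseteq> \<Union>(fib ` F)"
      using Ktop by (auto simp: fib_def F_def C_def)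
  qed (use fib_open in blast)
  then obtain T where T: "finite T" "T \<subseteq> F" "C \<subseteq> \<Union>(fib ` T)"
    by (metis finite_subset_image)
  have "F \<subseteq> T"
    using T(3) by (auto simp: F_def C_def fib_def)
  then show fin: "finite F"
    using T(1) finite_subset by blast
  have eq: "{y \<in> topspace X. r k y \<in> F} = \<Union>(fib ` F)"
    by (auto simp: fib_def)
  show "openin X {y \<in> topspace X. r k y \<in> F}"
    unfolding eq using fib_open by blast
  have "F \<subseteq> topspace X"
    using Ktop k by (auto simp: F_def)
  then have "closedin X F"
    using t1 fin t1_space_closedin_finite by blast
  then show "closedin X {y \<in> topspace X. r k y \<in> F}"
    by (rule closedin_continuous_map_preimage[OF cont[OF k]])
qed

text \<open>One round of the game with challenge \<open>K1\<close>. Some \<open>h\<close> in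
  \<open>G\<close> is close to \<open>f\<close> on a compact set containing \<open>K\<close> and
  \<open>K1\<close>; \<open>f'\<close> adds to \<open>f\<close> only the large coefficients of
  \<open>h - f\<close>. These sit over finitely many points, and those outside that compact set form
  \<open>L\<close>.\<close>

lemma fusion_step:
  assumes f: "f \<in> continuous_funs X" and K1: "compactin X K1"
    and K: "compactin X K" "invariant K" and e: "e > 0"
    and G: "openin (compact_open_topology X) G"
      "compact_open_topology X closure_of G = topspace (compact_open_topology X)"
  shows "\<exists>L f' K' e'. compactin X L \<and> K1 \<inter> L = {} \<and> K \<inter> L = {} \<and>
    f' \<in> continuous_funs X \<and> compactin X K' \<and> invariant K' \<and> K \<subseteq> K' \<and> 0 < e' \<and> e' \<le> e / 2 \<and>
    unif_nbhd X f' K' e' \<subseteq> G \<and>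
    (\<forall>y\<in>topspace X. (\<forall>k<n. r k y \<notin> L) \<longrightarrow> \<bar>f' y - f y\<bar> \<le> e / 4)"
proof -
  define K2 where "K2 = saturation (K \<union> K1)"
  have K2: "compactin X K2" "K \<subseteq> K2" "K1 \<subseteq> K2" "invariant K2"
    using saturation[OF compactin_Un[OF K(1) K1]] by (auto simp: K2_def)
  \<comment> \<open>At most \<open>n\<close> coefficients, each below \<open>2 * \<delta>\<close>,
    then change \<open>f\<close> by at most \<open>e / 4\<close>.\<close>
  define \<delta> where "\<delta> = e / (8 * (real n + 1))"
  have \<delta>: "\<delta> > 0" "real n * (2 * \<delta>) \<le> e / 4"
    using e by (auto simp: \<delta>_def field_simps)
  obtain h where h: "h \<in> G" "h \<in> unif_nbhd X f K2 \<delta>"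
    using G(2) f K2(1) \<delta>(1) unfolding dense_in_compact_open_topology_iff by blast
  obtain Kh \<epsilon> where Kh: "compactin X Kh" "\<epsilon> > 0" "unif_nbhd X h Kh \<epsilon> \<subseteq> G"
    using unif_nbhd_subset_open[OF G(1) h(1)] by blast
  define K' where "K' = saturation (K2 \<union> Kh)"
  have K': "compactin X K'" "K2 \<subseteq> K'" "Kh \<subseteq> K'" "invariant K'"
    using saturation[OF compactin_Un[OF K2(1) Kh(1)]] by (auto simp: K'_def)
  have K'top: "K' \<subseteq> topspace X"
    using K'(1) compactin_subset_topspace by blast
  define g where "g y = h y - f y" for y
  have cf: "continuous_map X euclideanreal f" and ch: "continuous_map X euclideanreal h"
    using f h(2) by (auto simp: continuous_funs_def unif_nbhd_def)
  have cg: "continuous_map X euclideanreal g"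
    unfolding g_def[abs_def] by (intro continuous_map_diff ch cf)
  have g_small: "\<bar>g y\<bar> < \<delta>" if "y \<in> K2" for y
    using h(2) that by (auto simp: g_def unif_nbhd_def)
  \<comment> \<open>The omitted coefficients cost at most \<open>\<epsilon> / 2\<close> on
    \<open>K'\<close>; the other half is left for the new tolerance.\<close>
  define \<eta> where "\<eta> = \<epsilon> / (2 * (real n + 1))"
  have \<eta>: "\<eta> > 0" "real n * \<eta> \<le> \<epsilon> / 2"
    using Kh(2) by (auto simp: \<eta>_def field_simps)
  define F where "F k = r k ` {y \<in> K'. \<bar>coef g k y\<bar> \<ge> \<eta>}" for k
  note F = finite_large_coef[OF cg K'(1) _ \<eta>(1), folded F_def]
  \<comment> \<open>The coefficient is kept on the whole clopen set of fibres over
    \<open>F k\<close>, not only inside \<open>K'\<close>, so that \<open>t k\<close> is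
    continuous.\<close>
  define t where "t k y = (if y \<in> {y \<in> topspace X. r k y \<in> F k} then coef g k y else 0)" for k y
  have ct: "continuous_map X euclideanreal (t k)" if "k < n" for k
    unfolding t_def[abs_def] using that
    by (intro continuous_map_real_clopen_cases continuous_coef cg F)
  define f' where "f' = restrict (\<lambda>y. f y + (\<Sum>k<n. t k y)) (topspace X)"
  \<comment> \<open>Points of \<open>K2\<close> can be left out: \<open>h\<close> is within
    \<open>\<delta>\<close> of \<open>f\<close> on this invariant set, so the coefficients over its
    points are small anyway.\<close>
  define L where "L = (\<Union>k<n. F k) - K2"
  show ?thesis
  proof (rule exI[of _ L], rule exI[of _ f'], rule exI[of _ K'], rule exI[of _ "min (\<epsilon> / 2) (e / 2)"],
      intro conjI ballI impI)
    have "F k \<subseteq> K'" if "k < n" for k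
      using K'(4) that unfolding invariant_def F_def by blast
    then have "L \<subseteq> topspace X"
      using K'top by (auto simp: L_def)
    moreover have "finite L"
      using F(1) by (auto simp: L_def)
    ultimately show "compactin X L"
      by (simp add: finite_imp_compactin)
    show "K1 \<inter> L = {}" "K \<inter> L = {}"
      using K2 by (auto simp: L_def)
    show "f' \<in> continuous_funs X"
      unfolding f'_def
      by (intro restrict_in_continuous_funs continuous_map_add continuous_map_sum cf ct) auto
    show "compactin X K'" "invariant K'" "K \<subseteq> K'"
      using K' K2 by auto
    show "0 < min (\<epsilon> / 2) (e / 2)" "min (\<epsilon> / 2) (e / 2) \<le> e / 2"
      using e Kh(2) by auto
    show "unif_nbhd X f' K' (min (\<epsilon> / 2) (e / 2)) \<subseteq> G"
    proof
      fix u assume u: "u \<in> unif_nbhd X f' K' (min (\<epsilon> / 2) (e / 2))"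
      have "\<bar>u y - h y\<bar> < \<epsilon>" if "y \<in> Kh" for y
      proof -
        have y: "y \<in> K'" "y \<in> topspace X"
          using that K' K'top by auto
        have "\<bar>t k y - coef g k y\<bar> \<le> \<eta>" if "k < n" for k
          using y \<eta>(1) by (auto simp: t_def F_def)
        then have "(\<Sum>k<n. \<bar>t k y - coef g k y\<bar>) \<le> real n * \<eta>"
          using sum_bounded_above[of "{..<n}" "\<lambda>k. \<bar>t k y - coef g k y\<bar>" \<eta>] by simp
        then have "\<bar>(\<Sum>k<n. t k y) - (\<Sum>k<n. coef g k y)\<bar> \<le> \<epsilon> / 2"
          using \<eta>(2) sum_abs[of "\<lambda>k. t k y - coef g k y" "{..<n}"] by (simp add: sum_subtractf)
        moreover have "f' y = f y + (\<Sum>k<n. t k y)" "(\<Sum>k<n. coef g k y) = h y - f y"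
          using y sum_coef[OF y(2), of g] by (auto simp: f'_def g_def)
        moreover have "\<bar>u y - f' y\<bar> < \<epsilon> / 2"
          using u y by (auto simp: unif_nbhd_def)
        ultimately show ?thesis
          by linarith
      qed
      then have "u \<in> unif_nbhd X h Kh \<epsilon>"
        using u by (auto simp: unif_nbhd_def)
      then show "u \<in> G"
        using Kh(3) by blast
    qed
    fix y assume y: "y \<in> topspace X" and notL: "\<forall>k<n. r k y \<notin> L"
    have "\<bar>t k y\<bar> \<le> 2 * \<delta>" if k: "k < n" for k
    proof (cases "r k y \<in> F k")
      case True
      then have "r k y \<in> K2"
        using notL k by (auto simp: L_def)
      then have "\<bar>coef g k (r k y)\<bar> < 2 * \<delta>"
        using abs_coef_less[OF k K2(4)] g_small by blast
      then show ?thesis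
        using \<delta>(1) by (simp add: t_def coef_r k y)
    qed (use \<delta>(1) in \<open>simp add: t_def\<close>)
    then have "(\<Sum>k<n. \<bar>t k y\<bar>) \<le> real n * (2 * \<delta>)"
      using sum_bounded_above[of "{..<n}" "\<lambda>k. \<bar>t k y\<bar>" "2 * \<delta>"] by simp
    then have "\<bar>\<Sum>k<n. t k y\<bar> \<le> e / 4"
      using \<delta>(2) sum_abs[of "\<lambda>k. t k y" "{..<n}"] by linarith
    then show "\<bar>f' y - f y\<bar> \<le> e / 4"
      using y by (simp add: f'_def)
  qed
qed

text \<open>The rounds of \<open>fusion_step\<close> are played along a locally finite run. A large
  change at \<open>y\<close> in round \<open>m\<close> requires some \<open>r k y\<close> in
  \<open>\<Lambda> m\<close>, so near each point the changes are eventually summable.\<close>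

theorem moving_off_property_imp_baire:
  assumes mop: "moving_off_property X"
  shows "baire_space (compact_open_topology X)"
  unfolding baire_space_def
proof (intro allI impI)
  fix G :: "nat \<Rightarrow> ('a \<Rightarrow> real) set"
  assume G: "\<forall>m. openin (compact_open_topology X) (G m) \<and>
              compact_open_topology X closure_of (G m) = topspace (compact_open_topology X)"
  show "compact_open_topology X closure_of (\<Inter>m. G m) = topspace (compact_open_topology X)"
    unfolding dense_in_compact_open_topology_iff
  proof (intro allI impI, elim conjE)
    fix f0 K0 and e0 :: real
    assume f0: "f0 \<in> continuous_funs X" and K0: "compactin X K0" and e0: "0 < e0"
    \<comment> \<open>A position holds the current function, the protected compact set, the
      tolerance and the index of the next dense open set.\<close>
    define I :: "('a \<Rightarrow> real) \<times> 'a set \<times> real \<times> nat \<Rightarrow> bool" where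
      "I = (\<lambda>(f, K, e, m). f \<in> continuous_funs X \<and> compactin X K \<and> invariant K \<and> 0 < e)"
    \<comment> \<open>Replies must miss the protected set as well as the challenge, so that what was
      achieved survives in the limit.\<close>
    define P :: "('a \<Rightarrow> real) \<times> 'a set \<times> real \<times> nat \<Rightarrow> 'a set \<Rightarrow> ('a \<Rightarrow> real) \<times> 'a set \<times> real \<times> nat \<Rightarrow> bool"
      where "P = (\<lambda>(f, K, e, m) L (f', K', e', m'). K \<inter> L = {} \<and> K \<subseteq> K' \<and> e' \<le> e / 2 \<and> m' = Suc m \<and>
         unif_nbhd X f' K' e' \<subseteq> G m \<and>
         (\<forall>y\<in>topspace X. (\<forall>k<n. r k y \<notin> L) \<longrightarrow> \<bar>f' y - f y\<bar> \<le> e / 4))"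
    have I0: "I (f0, saturation K0, e0, 0)"
      using f0 saturation[OF K0] e0 by (simp add: I_def)
    have step: "\<exists>L s'. compactin X L \<and> K1 \<inter> L = {} \<and> P s L s' \<and> I s'"
      if Is: "I s" and K1: "compactin X K1" for s K1
    proof -
      obtain f K e m where s: "s = (f, K, e, m)"
        by (metis prod_cases4)
      have "f \<in> continuous_funs X" "compactin X K" "invariant K" "0 < e"
        using Is by (auto simp: I_def s)
      then obtain L f' K' e' where L: "compactin X L" "K1 \<inter> L = {}" "K \<inter> L = {}"
        "f' \<in> continuous_funs X" "compactin X K'" "invariant K'" "K \<subseteq> K'" "0 < e'" "e' \<le> e / 2"
        "unif_nbhd X f' K' e' \<subseteq> G m"
        and close: "\<forall>y\<in>topspace X. (\<forall>k<n. r k y \<notin> L) \<longrightarrow> \<bar>f' y - f y\<bar> \<le> e / 4"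
        using fusion_step[OF _ K1 _ _ _ conjunct1[OF spec[OF G]] conjunct2[OF spec[OF G]], of f K e m]
        by (elim meta_impE exE conjE) blast+
      have "P s L (f', K', e', Suc m)" "I (f', K', e', Suc m)"
        using L close by (auto simp: P_def I_def s)
      with L(1,2) show ?thesis
        by blast
    qed
    obtain \<sigma> \<Lambda> where \<sigma>0: "\<sigma> 0 = (f0, saturation K0, e0, 0)" and I\<sigma>: "\<And>m. I (\<sigma> m)"
      and P\<sigma>: "\<And>m. P (\<sigma> m) (\<Lambda> m) (\<sigma> (Suc m))"
      and locfin: "\<And>x. x \<in> topspace X \<Longrightarrow> \<exists>W. openin X W \<and> x \<in> W \<and> finite {m. W \<inter> \<Lambda> m \<noteq> {}}"
      using compact_strategy_locally_finite_run[where I = I and P = P, OF mop I0 step] by blast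
    define f where "f m = fst (\<sigma> m)" for m
    define K where "K m = fst (snd (\<sigma> m))" for m
    define e where "e m = fst (snd (snd (\<sigma> m)))" for m
    have idx: "snd (snd (snd (\<sigma> m))) = m" for m
    proof (induction m)
      case 0
      then show ?case by (simp add: \<sigma>0)
    next
      case (Suc m)
      then show ?case
        using P\<sigma>[of m] by (auto simp: P_def split: prod.splits)
    qed
    have \<sigma>: "\<sigma> m = (f m, K m, e m, m)" for m
      using idx[of m] by (simp add: f_def K_def e_def prod_eq_iff)
    have f: "f m \<in> continuous_funs X" and K: "compactin X (K m)" "invariant (K m)" and e: "0 < e m" for m
      using I\<sigma>[of m] by (auto simp: I_def \<sigma>)
    have KL: "K m \<inter> \<Lambda> m = {}" and K_Suc: "K m \<subseteq> K (Suc m)" and e_Suc: "e (Suc m) \<le> e m / 2"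
      and sub: "unif_nbhd X (f (Suc m)) (K (Suc m)) (e (Suc m)) \<subseteq> G m"
      and close: "\<And>y. y \<in> topspace X \<Longrightarrow> (\<forall>k<n. r k y \<notin> \<Lambda> m) \<Longrightarrow> \<bar>f (Suc m) y - f m y\<bar> \<le> e m / 4" for m
      using P\<sigma>[of m] by (auto simp: P_def \<sigma>)
    have e_le: "e m \<le> e0 / 2 ^ m" for m
    proof (induction m)
      case 0
      then show ?case using \<sigma>0 by (simp add: \<sigma>)
    next
      case (Suc m)
      have "e (Suc m) \<le> e m / 2"
        by (rule e_Suc)
      also have "\<dots> \<le> e0 / 2 ^ m / 2"
        using Suc by (rule divide_right_mono) simp
      finally show ?case by (simp add: field_simps)
    qed
    have "(\<lambda>m. e0 / 2 ^ m) \<longlonglongrightarrow> 0"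
      by (rule LIMSEQ_divide_realpow_zero) simp
    then have e_lim: "e \<longlonglongrightarrow> 0"
      using e e_le by (intro tendsto_sandwich[of "\<lambda>_. 0" e sequentially "\<lambda>m. e0 / 2 ^ m" 0] tendsto_const)
        (auto intro!: eventuallyI less_imp_le)
    define F where "F y = lim (\<lambda>m. f m y)" for y
    have tail: "\<bar>F y - f m y\<bar> \<le> e m / 2"
      if y: "y \<in> topspace X" and avoid: "\<And>i. i \<ge> m \<Longrightarrow> \<forall>k<n. r k y \<notin> \<Lambda> i" for y m
    proof -
      \<comment> \<open>Each change is at most a quarter of a tolerance that at least halves every
        round, so the changes telescope to less than \<open>e i / 2\<close>.\<close>
      have diff: "\<bar>f (i + j) y - f i y\<bar> \<le> e i / 2 - e (i + j) / 2" if "i \<ge> m" for i j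
      proof (induction j)
        case (Suc j)
        have "\<bar>f (Suc (i + j)) y - f (i + j) y\<bar> \<le> e (i + j) / 4"
          by (rule close[OF y avoid]) (use that in simp)
        with Suc e_Suc[of "i + j"] show ?case
          unfolding add_Suc_right by linarith
      qed simp
      have "Cauchy (\<lambda>m. f m y)"
      proof (rule metric_CauchyI)
        fix \<epsilon> :: real assume "0 < \<epsilon>"
        then obtain N where N: "\<And>i. i \<ge> N \<Longrightarrow> e i < \<epsilon>"
          using order_tendstoD(2)[OF e_lim] unfolding eventually_sequentially by blast
        let ?M = "max m N"
        have "\<bar>f i y - f ?M y\<bar> < \<epsilon> / 2" if "i \<ge> ?M" for i
          using diff[of ?M "i - ?M"] N[of ?M] e[of i] that by simp
        then have "dist (f i y) (f j y) < \<epsilon>" if "i \<ge> ?M" "j \<ge> ?M" for i j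
          using that unfolding dist_real_def by (smt (verit) field_sum_of_halves)
        then show "\<exists>M. \<forall>i\<ge>M. \<forall>j\<ge>M. dist (f i y) (f j y) < \<epsilon>"
          by blast
      qed
      then have "(\<lambda>m. f m y) \<longlonglongrightarrow> F y"
        unfolding F_def by (simp add: Cauchy_convergent_iff convergent_LIMSEQ_iff)
      then have "(\<lambda>i. \<bar>f i y - f m y\<bar>) \<longlonglongrightarrow> \<bar>F y - f m y\<bar>"
        by (intro tendsto_intros)
      moreover have "\<bar>f i y - f m y\<bar> \<le> e m / 2" if "i \<ge> m" for i
        using diff[of m "i - m"] e[of i] that by simp
      ultimately show ?thesis
        by (intro LIMSEQ_le_const2) auto
    qed
    have cF: "continuous_map X euclideanreal F"
    proof (rule continuous_map_real_locally_approx)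
      fix x and \<epsilon> :: real assume x: "x \<in> topspace X" and \<epsilon>: "0 < \<epsilon>"
      have "\<forall>k. \<exists>W. k < n \<longrightarrow> openin X W \<and> r k x \<in> W \<and> finite {m. W \<inter> \<Lambda> m \<noteq> {}}"
        using locfin x r_in by metis
      then obtain W where W: "\<And>k. k < n \<Longrightarrow> openin X (W k)" "\<And>k. k < n \<Longrightarrow> r k x \<in> W k"
          "\<And>k. k < n \<Longrightarrow> finite {m. W k \<inter> \<Lambda> m \<noteq> {}}"
        by metis
      \<comment> \<open>All retracts of \<open>y\<close>, not only \<open>y\<close> itself, have to
        avoid the later replies, so local finiteness is pulled back along every
        \<open>r k\<close>.\<close>
      define U where "U = topspace X \<inter> (\<Inter>k<n. {z \<in> topspace X. r k z \<in> W k})"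
      have "n \<noteq> 0"
        using x height_pos by blast
      then have U: "openin X U"
        unfolding U_def using openin_continuous_map_preimage[OF cont W(1)]
        by (intro openin_Int openin_INT2) auto
      have "finite (\<Union>k<n. {m. W k \<inter> \<Lambda> m \<noteq> {}})"
        using W(3) by blast
      then obtain M where M: "\<And>k m. k < n \<Longrightarrow> W k \<inter> \<Lambda> m \<noteq> {} \<Longrightarrow> m < M"
        unfolding finite_nat_set_iff_bounded by blast
      obtain N where N: "\<And>i. i \<ge> N \<Longrightarrow> e i < \<epsilon>"
        using order_tendstoD(2)[OF e_lim \<epsilon>] unfolding eventually_sequentially by blast
      define m where "m = max M N"
      have "\<bar>F y - f m y\<bar> < \<epsilon>" if "y \<in> U" for y
      proof -
        have "r k y \<notin> \<Lambda> i" if "i \<ge> m" "k < n" for i k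
          using \<open>y \<in> U\<close> M[of k i] that by (fastforce simp: U_def m_def)
        then have "\<bar>F y - f m y\<bar> \<le> e m / 2"
          using that by (intro tail) (auto simp: U_def)
        then show ?thesis
          using N[of m] e[of m] by (simp add: m_def)
      qed
      then show "\<exists>W g. openin X W \<and> x \<in> W \<and> continuous_map X euclideanreal g \<and> (\<forall>y\<in>W. \<bar>F y - g y\<bar> < \<epsilon>)"
        using U x W(2) f[of m] by (intro exI[of _ U] exI[of _ "f m"]) (auto simp: U_def continuous_funs_def)
    qed
    define F' where "F' = restrict F (topspace X)"
    have K_mono: "K m \<subseteq> K i" if "m \<le> i" for m i
      using that K_Suc by (rule lift_Suc_mono_le[rotated])
    \<comment> \<open>From round \<open>m\<close> on, all retracts of a point of \<open>K m\<close>
      lie in the protected sets, which the replies miss; hence \<open>tail\<close> applies on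
      \<open>K m\<close>.\<close>
    have mem: "F' \<in> unif_nbhd X (f m) (K m) (e m)" for m
    proof -
      have "\<bar>F' y - f m y\<bar> < e m" if y: "y \<in> K m" for y
      proof -
        have ytop: "y \<in> topspace X"
          using y K(1) compactin_subset_topspace by blast
        have "r k y \<notin> \<Lambda> i" if "i \<ge> m" "k < n" for i k
        proof -
          have "r k y \<in> K i"
            using y K_mono[OF that(1)] K(2)[of i] that(2) unfolding invariant_def by blast
          then show ?thesis
            using KL[of i] by blast
        qed
        then have "\<bar>F y - f m y\<bar> \<le> e m / 2"
          using ytop by (intro tail) auto
        then show ?thesis
          using e[of m] ytop by (simp add: F'_def)
      qed
      then show ?thesis
        unfolding unif_nbhd_def F'_def using restrict_in_continuous_funs[OF cF] by blast
    qed
    have "F' \<in> (\<Inter>m. G m)"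
      using mem sub by blast
    moreover have "F' \<in> unif_nbhd X f0 K0 e0"
      using mem[of 0] \<sigma>0 unif_nbhd_mono[OF saturation(2)[OF K0] order_refl, of X f0 e0] by (auto simp: \<sigma>)
    ultimately show "(\<Inter>m. G m) \<inter> unif_nbhd X f0 K0 e0 \<noteq> {}"
      by blast
  qed
qed

end

subsection \<open>Retractions of stratifiable spaces\<close>

text \<open>This operator plays the role of Borges' \<open>U\<^sub>x\<close> in his extension theorem for stratifiable
  spaces; by symmetry the last clause contains monotone normality.\<close>

lemma stratifiable_space_neighbourhood_operator:
  fixes X :: "'a topology"
  assumes "stratifiable_space X"
  obtains H :: "'a \<Rightarrow> 'a set \<Rightarrow> 'a set" and N :: "'a \<Rightarrow> 'a set \<Rightarrow> nat" where
    "\<And>x A. openin X A \<Longrightarrow> x \<in> A \<Longrightarrow> openin X (H x A) \<and> x \<in> H x A \<and> H x A \<subseteq> A"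
    "\<And>x A y B. \<lbrakk>openin X A; x \<in> A; openin X B; y \<in> B; H x A \<inter> H y B \<noteq> {}; N x A \<le> N y B\<rbrakk> \<Longrightarrow> y \<in> A"
proof -
  obtain U :: "'a \<Rightarrow> nat \<Rightarrow> 'a set" where
    U: "\<And>x n. x \<in> topspace X \<Longrightarrow> U x n \<subseteq> topspace X"
    and nbhd: "\<And>x n. x \<in> topspace X \<Longrightarrow> \<exists>V. openin X V \<and> x \<in> V \<and> V \<subseteq> U x n"
    and dec: "\<And>x n. x \<in> topspace X \<Longrightarrow> U x (Suc n) \<subseteq> U x n"
    and strat: "\<And>F. closedin X F \<Longrightarrow> F = (\<Inter>n. X closure_of (\<Union>x\<in>F. U x n))"
    using assms unfolding stratifiable_space_def by metis
  have anti: "U x n \<subseteq> U x m" if "x \<in> topspace X" "m \<le> n" for x m n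
    using that(2) by (rule lift_Suc_antimono_le[of "U x", rotated]) (rule dec[OF that(1)])
  \<comment> \<open>For open \<open>A\<close> the closed sets \<open>C A n\<close> intersect in the
    complement of \<open>A\<close>, so each point of \<open>A\<close> has a first stage
    \<open>N x A\<close> at which it is left out.\<close>
  define C where "C A n = X closure_of (\<Union>z\<in>topspace X - A. U z n)" for A n
  define N where "N x A = (LEAST n. x \<notin> C A n)" for x A
  define H where "H x A = X interior_of (U x (N x A)) - C A (N x A)" for x A
  have N: "x \<notin> C A (N x A)" if "openin X A" "x \<in> A" for x A
  proof -
    have "closedin X (topspace X - A)"
      using that(1) by blast
    then have "\<exists>n. x \<notin> C A n"
      using strat that(2) unfolding C_def by blast
    then show ?thesis
      unfolding N_def by (rule LeastI_ex)
  qed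
  have in_C: "U z n \<subseteq> C A n" if "z \<in> topspace X - A" for z n A
  proof -
    have "(\<Union>z\<in>topspace X - A. U z n) \<subseteq> C A n"
      unfolding C_def using U by (intro closure_of_subset) blast
    then show ?thesis
      using that by blast
  qed
  have in_U: "x \<in> X interior_of (U x n)" if "x \<in> topspace X" for x n
    using nbhd[OF that, of n] by (auto simp: interior_of_def)
  show thesis
  proof (rule that)
    fix x A assume A: "openin X A" "x \<in> A"
    then have x: "x \<in> topspace X"
      using openin_subset by blast
    have "openin X (H x A)"
      unfolding H_def C_def by (intro openin_diff openin_interior_of closedin_closure_of)
    moreover have "x \<in> H x A"
      unfolding H_def using N[OF A] in_U[OF x] by blast
    moreover have "H x A \<subseteq> A"
    proof
      fix w assume w: "w \<in> H x A"
      then have wtop: "w \<in> topspace X"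
        using \<open>openin X (H x A)\<close> openin_subset by blast
      show "w \<in> A"
      proof (rule ccontr)
        assume "w \<notin> A"
        then have "w \<in> C A (N x A)"
          using in_C[of w A "N x A"] in_U[OF wtop, of "N x A"] interior_of_subset[of X "U w (N x A)"] wtop
          by blast
        then show False
          using w by (simp add: H_def)
      qed
    qed
    ultimately show "openin X (H x A) \<and> x \<in> H x A \<and> H x A \<subseteq> A"
      by blast
  next
    fix x A y B
    assume AB: "openin X A" "x \<in> A" "openin X B" "y \<in> B" "H x A \<inter> H y B \<noteq> {}" "N x A \<le> N y B"
    show "y \<in> A"
    proof (rule ccontr)
      assume "y \<notin> A"
      moreover have y: "y \<in> topspace X"
        using AB openin_subset by blast
      moreover obtain w where w: "w \<in> H x A" "w \<in> H y B"
        using AB(5) by blast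
      \<comment> \<open>For \<open>y\<close> outside \<open>A\<close>, the set
        \<open>U y (N x A)\<close> is part of \<open>C A (N x A)\<close>, which was removed from
        \<open>H x A\<close>.\<close>
      have "w \<in> U y (N y B)"
        using w(2) interior_of_subset unfolding H_def by fast
      then have "w \<in> U y (N x A)"
        using anti[OF y AB(6)] by blast
      ultimately have "w \<in> C A (N x A)"
        using in_C by blast
      then show False
        using w(1) by (simp add: H_def)
    qed
  qed
qed

lemma stratifiable_imp_Hausdorff_space:
  "stratifiable_space X \<Longrightarrow> Hausdorff_space X"
  unfolding stratifiable_space_def by (metis regular_t1_imp_Hausdorff_space)

text \<open>If the neighbourhoods of \<open>x\<close> in \<open>S\<close> and \<open>y\<close> in
  \<open>T\<close> met, comparing their \<open>N\<close> would place \<open>y\<close> outside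
  \<open>T\<close> or \<open>x\<close> outside \<open>S\<close>.\<close>

lemma stratifiable_imp_normal_space:
  assumes "stratifiable_space X"
  shows "normal_space X"
  unfolding normal_space_def
proof (intro allI impI, elim conjE)
  fix S T assume ST: "closedin X S" "closedin X T" "disjnt S T"
  obtain H :: "'a \<Rightarrow> 'a set \<Rightarrow> 'a set" and N where
    H: "\<And>x A. openin X A \<Longrightarrow> x \<in> A \<Longrightarrow> openin X (H x A) \<and> x \<in> H x A \<and> H x A \<subseteq> A"
    and HN: "\<And>x A y B. \<lbrakk>openin X A; x \<in> A; openin X B; y \<in> B; H x A \<inter> H y B \<noteq> {}; N x A \<le> (N y B :: nat)\<rbrakk> \<Longrightarrow> y \<in> A"
    using stratifiable_space_neighbourhood_operator[OF assms] by blast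
  let ?S = "topspace X - S" and ?T = "topspace X - T"
  have op: "openin X ?S" "openin X ?T"
    using ST by auto
  have S: "x \<in> ?T" if "x \<in> S" for x
    using that ST closedin_subset by (fastforce simp: disjnt_def)
  have T: "x \<in> ?S" if "x \<in> T" for x
    using that ST closedin_subset by (fastforce simp: disjnt_def)
  have disj: "H x ?T \<inter> H y ?S = {}" if "x \<in> S" "y \<in> T" for x y
  proof (rule ccontr)
    assume ne: "H x ?T \<inter> H y ?S \<noteq> {}"
    show False
    proof (cases "N x ?T \<le> N y ?S")
      case True
      then show ?thesis
        using HN[OF op(2) S[OF that(1)] op(1) T[OF that(2)] ne] that by blast
    next
      case False
      then show ?thesis
        using HN[OF op(1) T[OF that(2)] op(2) S[OF that(1)]] ne that by (simp add: Int_commute)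
    qed
  qed
  show "\<exists>U V. openin X U \<and> openin X V \<and> S \<subseteq> U \<and> T \<subseteq> V \<and> disjnt U V"
  proof (intro exI conjI)
    show "openin X (\<Union>x\<in>S. H x ?T)" "openin X (\<Union>y\<in>T. H y ?S)"
      using H op S T by blast+
    show "S \<subseteq> (\<Union>x\<in>S. H x ?T)" "T \<subseteq> (\<Union>y\<in>T. H y ?S)"
      using H op S T by blast+
    show "disjnt (\<Union>x\<in>S. H x ?T) (\<Union>y\<in>T. H y ?S)"
      using disj unfolding disjnt_def by blast
  qed
qed

text \<open>Following Borges, an isolated point \<open>z\<close> goes to a point of \<open>B\<close> to which it is closest, as measured
  by \<open>N\<close>.\<close>

lemma stratifiable_space_retraction:
  fixes X :: "'a topology"
  assumes strat: "stratifiable_space X"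
    and A: "A \<subseteq> topspace X" and B: "closedin X B" "B \<subseteq> A" "B \<noteq> {}"
    and isolated: "\<And>z. z \<in> A - B \<Longrightarrow> \<exists>W. openin X W \<and> W \<inter> A = {z}"
  shows "\<exists>s. continuous_map (subtopology X A) (subtopology X B) s \<and> (\<forall>b\<in>B. s b = b)"
proof -
  obtain H :: "'a \<Rightarrow> 'a set \<Rightarrow> 'a set" and N where
    H: "\<And>x A. openin X A \<Longrightarrow> x \<in> A \<Longrightarrow> openin X (H x A) \<and> x \<in> H x A \<and> H x A \<subseteq> A"
    and HN: "\<And>x A y B. \<lbrakk>openin X A; x \<in> A; openin X B; y \<in> B; H x A \<inter> H y B \<noteq> {}; N x A \<le> (N y B :: nat)\<rbrakk> \<Longrightarrow> y \<in> A"
    using stratifiable_space_neighbourhood_operator[OF strat] by blast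
  \<comment> \<open>The pairs \<open>(y, W)\<close> with \<open>y\<close> in \<open>B\<close> whose
    neighbourhood catches \<open>z\<close>; a larger \<open>N\<close> counts as closer.\<close>
  define S where "S z = (\<lambda>(y, W). openin X W \<and> y \<in> B \<and> y \<in> W \<and> z \<in> H y W)" for z
  have ex: "\<exists>c. c \<in> B \<and> (\<forall>p. S z p \<longrightarrow> (\<exists>W. S z (c, W) \<and> case_prod N p \<le> N c W))"
    if z: "z \<in> A - B" for z
  proof (cases "\<exists>p. S z p")
    case True
    then obtain p where p: "S z p" ..
    let ?Z = "topspace X - B"
    have Z: "openin X ?Z" "z \<in> ?Z"
      using z A B by auto
    \<comment> \<open>Otherwise the operator, applied to \<open>z\<close> and the open complement of
      \<open>B\<close>, would expel \<open>y\<close> from \<open>B\<close>. Hence a closest pair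
      exists.\<close>
    have bound: "\<forall>p. S z p \<longrightarrow> case_prod N p < N z ?Z"
    proof (intro allI impI, rule ccontr)
      fix p assume p: "S z p" "\<not> case_prod N p < N z ?Z"
      then obtain y W where yW: "p = (y, W)" "openin X W" "y \<in> B" "y \<in> W" "z \<in> H y W"
        by (auto simp: S_def)
      have "y \<in> ?Z"
        by (rule HN[OF Z yW(2,4)]) (use H[OF Z] yW p in auto)
      then show False
        using yW by blast
    qed
    obtain c W where "S z (c, W)" "\<forall>p. S z p \<longrightarrow> case_prod N p \<le> N c W"
      using ex_has_greatest_nat[of "S z" p "case_prod N" "N z ?Z", OF p bound] by auto
    then show ?thesis
      by (intro exI[of _ c]) (auto simp: S_def)
  next
    \<comment> \<open>A point caught by no neighbourhood may go anywhere, since continuity at points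
      of \<open>B\<close> is tested on caught points only.\<close>
    case False
    then show ?thesis
      using B(3) by blast
  qed
  then obtain c where c: "\<And>z. z \<in> A - B \<Longrightarrow> c z \<in> B"
    and best: "\<And>z p. z \<in> A - B \<Longrightarrow> S z p \<Longrightarrow> \<exists>W. S z (c z, W) \<and> case_prod N p \<le> N (c z) W"
    by metis
  define s where "s z = (if z \<in> B then z else c z)" for z
  have sB: "s z \<in> B" if "z \<in> A" for z
    using that c by (auto simp: s_def)
  \<comment> \<open>Continuity on \<open>B\<close>: the pair maximal for \<open>w\<close> has
    \<open>N\<close> at least \<open>N b V\<close>, and both neighbourhoods contain
    \<open>w\<close>, which forces \<open>c w\<close> into \<open>V\<close>.\<close>
  have near: "s w \<in> V" if V: "openin X V" "b \<in> V" "b \<in> B" and w: "w \<in> A" "w \<in> H b V" for b V w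
  proof (cases "w \<in> B")
    case True
    then show ?thesis
      using H[OF V(1,2)] w by (auto simp: s_def)
  next
    case False
    then have "S w (b, V)" "w \<in> A - B"
      using V w by (auto simp: S_def)
    then obtain W where W: "S w (c w, W)" "N b V \<le> N (c w) W"
      using best by fastforce
    then have "c w \<in> V"
      using HN[OF V(1,2), of W "c w"] w(2) by (auto simp: S_def)
    then show ?thesis
      using False by (simp add: s_def)
  qed
  have "continuous_map (subtopology X A) (subtopology X B) s"
    unfolding continuous_map_in_subtopology
  proof
    show "s \<in> topspace (subtopology X A) \<rightarrow> B"
      using sB by auto
    show "continuous_map (subtopology X A) X s"
      unfolding continuous_map_eq_topcontinuous_at topcontinuous_at_def
    proof (intro ballI conjI allI impI)
      fix x assume x: "x \<in> topspace (subtopology X A)"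
      then show "x \<in> topspace (subtopology X A)" .
      show "s \<in> topspace (subtopology X A) \<rightarrow> topspace X"
        using sB B A by auto
      fix V assume V: "openin X V \<and> s x \<in> V"
      show "\<exists>U. openin (subtopology X A) U \<and> x \<in> U \<and> (\<forall>y\<in>U. s y \<in> V)"
      proof (cases "x \<in> B")
        case True
        then have xV: "openin X V" "x \<in> V"
          using V by (auto simp: s_def)
        have "openin (subtopology X A) (H x V \<inter> A)"
          using H[OF xV] by (auto simp: openin_subtopology)
        then show ?thesis
          using H[OF xV] x near[OF xV True] by (intro exI[of _ "H x V \<inter> A"]) auto
      next
        case False
        then obtain W where "openin X W" "W \<inter> A = {x}"
          using isolated[of x] x by auto
        then have "openin (subtopology X A) {x}"
          by (metis openin_subtopology)
        then show ?thesis
          using V by blast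
      qed
    qed
  qed
  then show ?thesis
    by (intro exI[of _ s]) (simp add: s_def)
qed

section \<open>Derivatives of finite order\<close>

lemma scattered_derivative_0: "scattered_derivative X 0 = topspace X"
  by (simp add: scattered_derivative.simps)

text \<open>The intersection over all earlier stages collapses to its last term because the
  derivatives decrease.\<close>

lemma scattered_derivative_Suc:
  "scattered_derivative X (Suc n) = nonisolated_points X (scattered_derivative X n)"
proof -
  let ?D = "scattered_derivative X" and ?N = "nonisolated_points X"
  have eq: "?D (Suc n) = (\<Inter>k\<in>{..<Suc n}. ?N (?D k))"
    by (subst scattered_derivative.simps) simp
  have "?N (?D n) \<subseteq> ?D n"
    by (auto simp: nonisolated_points_def)
  moreover have "?D n \<subseteq> ?N (?D k)" if "k < n" for k
    using that by (subst scattered_derivative.simps) auto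
  ultimately have "?N (?D n) \<subseteq> ?N (?D k)" if "k < Suc n" for k
    using that by (cases "k = n") (simp, metis less_SucE order_trans)
  then show ?thesis
    unfolding eq by blast
qed

lemma scattered_derivative_Suc_subset:
  "scattered_derivative X (Suc n) \<subseteq> scattered_derivative X n"
  by (auto simp: scattered_derivative_Suc nonisolated_points_def)

lemma scattered_derivative_subset_topspace:
  "scattered_derivative X n \<subseteq> topspace X"
proof (induction n)
  case (Suc n)
  then show ?case
    using scattered_derivative_Suc_subset order_trans by metis
qed (simp add: scattered_derivative_0)

lemma scattered_derivative_isolated:
  assumes "z \<in> scattered_derivative X n - scattered_derivative X (Suc n)"
  shows "\<exists>W. openin X W \<and> W \<inter> scattered_derivative X n = {z}"
  using assms unfolding scattered_derivative_Suc nonisolated_points_def isolated_point_of_def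
  by (auto simp: openin_subtopology)

text \<open>Every point removed at this step has an open neighbourhood that misses the next
  derivative.\<close>

lemma closedin_scattered_derivative: "closedin X (scattered_derivative X n)"
proof (induction n)
  case 0
  then show ?case
    by (simp add: scattered_derivative_0)
next
  case (Suc n)
  let ?D = "scattered_derivative X"
  define \<W> where "\<W> = {W. openin X W \<and> W \<inter> ?D (Suc n) = {}}"
  have "z \<in> \<Union>\<W>" if z: "z \<in> ?D n - ?D (Suc n)" for z
  proof -
    obtain W where "openin X W" "W \<inter> ?D n = {z}"
      using scattered_derivative_isolated[OF z] by blast
    then have "W \<in> \<W>" "z \<in> W"
      using z scattered_derivative_Suc_subset[of X n] by (auto simp: \<W>_def)
    then show ?thesis
      by blast
  qed
  then have "?D (Suc n) = ?D n - \<Union>\<W>"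
    using scattered_derivative_Suc_subset[of X n] unfolding \<W>_def by blast
  moreover have "openin X (\<Union>\<W>)"
    unfolding \<W>_def by blast
  ultimately show ?case
    using Suc by (metis closedin_diff)
qed

lemma scattered_derivative_eventually_empty:
  assumes "scattered_space X" "finite_scattered_height X"
  shows "\<exists>n. scattered_derivative X n = {}"
proof -
  obtain n where n: "scattered_derivative X n = scattered_derivative X (Suc n)"
    using assms(2) unfolding finite_scattered_height_def by blast
  have "scattered_derivative X n = {}"
  proof (rule ccontr)
    assume "scattered_derivative X n \<noteq> {}"
    then obtain x where "isolated_point_of X (scattered_derivative X n) x"
      using assms(1) scattered_derivative_subset_topspace[of X n] unfolding scattered_space_def by metis
    then show False
      using n unfolding scattered_derivative_Suc nonisolated_points_def isolated_point_of_def by blast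
  qed
  then show ?thesis ..
qed

text \<open>\<open>r k\<close> is the composite of the first \<open>k\<close> one-step retractions
  between consecutive derivatives.\<close>

lemma retraction_tower_exists:
  fixes X :: "'a topology"
  assumes strat: "stratifiable_space X" and "scattered_space X" "finite_scattered_height X"
  shows "\<exists>n r. retraction_tower X n r"
proof -
  let ?D = "scattered_derivative X"
  \<comment> \<open>Minimality keeps the earlier derivatives non-empty, as
    \<open>stratifiable_space_retraction\<close> requires of its target.\<close>
  define n where "n = (LEAST n. ?D n = {})"
  have Dn: "?D n = {}"
    unfolding n_def using scattered_derivative_eventually_empty[OF assms(2,3)] by (rule LeastI_ex)
  have ne: "?D k \<noteq> {}" if "k < n" for k
    using not_less_Least that unfolding n_def by blast
  have "\<exists>s. continuous_map (subtopology X (?D k)) (subtopology X (?D (Suc k))) s \<and> (\<forall>b\<in>?D (Suc k). s b = b)"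
    if "Suc k < n" for k
    by (rule stratifiable_space_retraction[OF strat scattered_derivative_subset_topspace
          closedin_scattered_derivative scattered_derivative_Suc_subset ne[OF that] scattered_derivative_isolated])
  then obtain s where s: "\<And>k. Suc k < n \<Longrightarrow> continuous_map (subtopology X (?D k)) (subtopology X (?D (Suc k))) (s k)"
    and s_id: "\<And>k b. Suc k < n \<Longrightarrow> b \<in> ?D (Suc k) \<Longrightarrow> s k b = b"
    by metis
  define r where "r = rec_nat id (\<lambda>k f. s k \<circ> f)"
  have r_0: "r 0 = id" and r_Suc: "r (Suc k) = s k \<circ> r k" for k
    by (auto simp: r_def)
  have r: "continuous_map X (subtopology X (?D k)) (r k)" if "k < n" for k
    using that
  proof (induction k)
    case 0
    then show ?case
      by (simp add: r_0 scattered_derivative_0)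
  next
    case (Suc k)
    then show ?case
      unfolding r_Suc using s by (intro continuous_map_compose) auto
  qed
  have anti: "?D j \<subseteq> ?D i" if "i \<le> j" for i j
    using that by (rule lift_Suc_antimono_le[of ?D, rotated]) (rule scattered_derivative_Suc_subset)
  have r_id: "r k x = x" if "k < n" "x \<in> ?D k" for k x
    using that
  proof (induction k)
    case (Suc k)
    then show ?case
      using s_id anti[of k "Suc k"] by (auto simp: r_Suc)
  qed (simp add: r_0)
  have rD: "r k x \<in> ?D k" if "k < n" "x \<in> topspace X" for k x
    using r[OF that(1)] that(2) by (auto simp: continuous_map_in_subtopology)
  have "retraction_tower X n r"
  proof
    show "t1_space X"
      using strat by (simp add: stratifiable_space_def)
    show "0 < n" if "x \<in> topspace X" for x
      using that Dn by (metis empty_iff gr0I scattered_derivative_0)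
    show "continuous_map X X (r k)" if "k < n" for k
      using r[OF that] continuous_map_in_subtopology by blast
    show "r 0 x = x" for x
      by (simp add: r_0)
    \<comment> \<open>For \<open>i \<le> j\<close> the point \<open>r j x\<close> lies in a
      derivative that \<open>r i\<close> fixes pointwise; otherwise \<open>r i\<close> factors
      through \<open>r j\<close>.\<close>
    show "r i (r j x) = r (max i j) x" if "i < n" "j < n" "x \<in> topspace X" for i j x
    proof (cases "i \<le> j")
      case True
      then show ?thesis
        using r_id[OF that(1)] rD[OF that(2,3)] anti[OF True] by (auto simp: max_def)
    next
      case False
      then have "j \<le> i" by simp
      then have "r i (r j x) = r i x"
        using \<open>i < n\<close>
      proof (induction i rule: dec_induct)
        case base
        then show ?case
          using r_id[OF that(2)] rD[OF that(2,3)] by simp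
      next
        case (step i)
        then show ?case
          by (simp add: r_Suc)
      qed
      then show ?thesis
        using False by (simp add: max_def)
    qed
    show "openin X {y \<in> topspace X. r k y = x}"
      if k: "k < n" and x: "x \<in> topspace X" "r k x = x" and top: "Suc k < n \<Longrightarrow> r (Suc k) x \<noteq> x" for k x
    proof -
      \<comment> \<open>Points of the next derivative are fixed by \<open>r (Suc k)\<close>, and for
        \<open>Suc k = n\<close> that derivative is empty.\<close>
      have "x \<notin> ?D (Suc k)"
        using top r_id[of "Suc k" x] k Dn by (cases "Suc k = n") auto
      then have "x \<in> ?D k - ?D (Suc k)"
        using rD[OF k x(1)] x(2) by simp
      then obtain W where W: "openin X W" "W \<inter> ?D k = {x}"
        using scattered_derivative_isolated[of x X k] by metis
      then have "openin (subtopology X (?D k)) {x}"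
        by (metis openin_subtopology)
      then have "openin X {y \<in> topspace X. r k y \<in> {x}}"
        by (rule openin_continuous_map_preimage[OF r[OF k]])
      then show ?thesis
        by simp
    qed
  qed
  then show ?thesis
    by blast
qed

theorem corollary1p4:
  fixes X :: "'a topology"
  assumes "stratifiable_space X"
    and "scattered_space X"
    and "finite_scattered_height X"
  shows "baire_space (compact_open_topology X) \<longleftrightarrow> moving_off_property X"
proof
  show "moving_off_property X" if "baire_space (compact_open_topology X)"
    using baire_imp_moving_off_property stratifiable_imp_Hausdorff_space[OF assms(1)]
      stratifiable_imp_normal_space[OF assms(1)] that by blast
  obtain n r where "retraction_tower X n r"
    using retraction_tower_exists[OF assms] by metis
  then show "baire_space (compact_open_topology X)" if "moving_off_property X"
    using that by (rule retraction_tower.moving_off_property_imp_baire)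
qed

end
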